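(* For all integers $r \geq 3$, $s \geq 3$, $t \geq 1$ and every real $\epsilon > 0$, there exists $m_0$ such that the following holds. If $m \geq m_0$ and $G$ is a graph with $m$ edges such that \[ \kappa_s(G) \geq \mathrm{mex}_{K_s}(m, K_{r+1}) + \epsilon m^{s/2}, \] then $G$ contains $K_{r+1}[t]$ as a subgraph.
   Context: All graphs are finite and simple. For a graph $G$, $\kappa_s(G)$ denotes the number of copies of the complete graph $K_s$ in $G$ (i.e. the number of $s$-cliques). For graphs $T$ and $F$, $\mathrm{mex}_T(m,F)$ is the maximum number of copies of $T$ in an $F$-free graph with exactly $m$ edges, where no restriction is placed on the number of vertices. For a graph $H$ and positive integer $t$, $H[t]$ is the $t$-fold blowup of $H$: every vertex of $H$ is replaced by an independent set of size $t$ and every edge by a complete bipartite graph $K_{t,t}$ between the corresponding sets. *)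

theory Defs
  imports Complex_Main "HOL-Library.Ramsey"
begin

datatype 'a graph = Graph (verts: "'a set") (edges: "'a set set")

definition simple_graph :: "'a graph \<Rightarrow> bool" where
  "simple_graph G \<longleftrightarrow> finite (verts G) \<and> edges G \<subseteq> [verts G]\<^bsup>2\<^esup>"

definition subgraph :: "'a graph \<Rightarrow> 'a graph \<Rightarrow> bool" where
  "subgraph H G \<longleftrightarrow> verts H \<subseteq> verts G \<and> edges H \<subseteq> edges G"

definition isomorphic :: "'a graph \<Rightarrow> 'b graph \<Rightarrow> bool" where
  "isomorphic G H \<longleftrightarrow> (\<exists>f. bij_betw f (verts G) (verts H) \<and> edges H = (\<lambda>e. f ` e) ` edges G)"

text \<open>A copy is a (not necessarily induced) subgraph, so that copies are counted
  as subgraphs and not as embeddings.\<close>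

definition copies :: "'b graph \<Rightarrow> 'a graph \<Rightarrow> 'a graph set" where
  "copies T G = {H. simple_graph H \<and> subgraph H G \<and> isomorphic T H}"

definition contains :: "'a graph \<Rightarrow> 'b graph \<Rightarrow> bool" where
  "contains G F \<longleftrightarrow> copies F G \<noteq> {}"

definition complete_graph :: "nat \<Rightarrow> nat graph" where
  "complete_graph n = Graph {..<n} ([{..<n}]\<^bsup>2\<^esup>)"

definition kappa :: "nat \<Rightarrow> 'a graph \<Rightarrow> nat" where
  "kappa s G = card (copies (complete_graph s) G)"

text \<open>The host graphs range over all finite simple graphs with vertices in \<^typ>\<open>nat\<close>,
  hence over all finite simple graphs up to isomorphism, with no bound on the number
  of vertices. If \<open>T\<close> has no isolated vertices, a copy of \<open>T\<close> is determined by its edges,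
  so there are at most \<open>2 ^ m\<close> copies and the maximum is over a finite set.  If \<open>F\<close> has a
  vertex of degree at least two, this set is nonempty because a matching is \<open>F\<close>-free.
  In other cases the value of \<open>mex\<close> may be meaningless.\<close>

definition mex :: "'b graph \<Rightarrow> nat \<Rightarrow> 'c graph \<Rightarrow> nat" where
  "mex T m F = Max {card (copies T G) | G :: nat graph.
     simple_graph G \<and> card (edges G) = m \<and> \<not> contains G F}"

definition blowup :: "'a graph \<Rightarrow> nat \<Rightarrow> ('a \<times> nat) graph" where
  "blowup H t = Graph (verts H \<times> {..<t})
     {{(u, i), (v, j)} | u v i j. {u, v} \<in> edges H \<and> i < t \<and> j < t}"

end

theory Submission
  imports Defs
begin

text \<open>Write \<open>c = (r choose s) / (r choose 2) powr (s / 2)\<close>. Weighted symmetrisation shows that a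
  \<open>K\<^sub>r\<^sub>+\<^sub>1\<close>-free graph with \<open>m\<close> edges has at most \<open>c * m powr (s / 2)\<close> cliques of size \<open>s\<close>, and
  Turan graphs show that this is asymptotically the value of \<open>mex\<close>.
  In a graph with \<open>m\<close> edges, vertices of degree below \<open>\<delta> * sqrt m\<close> lie in only
  \<open>2 * \<delta> * m powr (s / 2)\<close> cliques of size \<open>s\<close>, and the other vertices number \<open>n \<le> (2 / \<delta>) * sqrt m\<close>;
  so the problem becomes one about dense graphs. There, averaging the bound for clique-free graphs
  over random vertex subsets of constant size turns an excess of \<open>s\<close>-cliques into
  \<open>\<rho> * n ^ (r + 1)\<close> cliques of size \<open>r + 1\<close> (so the removal lemma is not needed), and
  Erdos's theorem on dense hypergraphs then gives the blowup.\<close>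

section \<open>Cliques and weighted symmetrisation\<close>

text \<open>The number of vertices is unrestricted, so \<open>m powr (s / 2)\<close> may be
  negligible against the \<open>s\<close>-th power of the order of the graph, and a supersaturation
  statement for dense graphs does not apply directly. Restricting to vertices of high degree loses
  only cliques counted with a factor \<open>\<delta> ^ (s - 2)\<close>, and this is small because
  \<open>s \<ge> 3\<close>. Weights enter because merging two vertices transfers mass at a
  fractional rate. Holding the edge sum fixed, rather than the total weight, yields a bound in terms
  of \<open>m\<close> alone. In the averaging, a sample with \<open>P\<close> edges contributes
  \<open>P powr (s / 2)\<close>, which is convex in \<open>P\<close>, so Jensen's inequality points
  the wrong way and \<open>P\<close> has to be shown to be concentrated. Samples of \<open>k\<close>
  vertices have variance \<open>O(k ^ 3)\<close>, hence deviation \<open>O(k powr (3 / 2))\<close>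
  on the scale \<open>k\<^sup>2\<close>. Taking \<open>k = l\<^sup>2\<close> keeps all exponents
  integral and leaves a relative error of order \<open>1 / l\<close>.\<close>

definition clique :: "'a set set \<Rightarrow> 'a set \<Rightarrow> bool" where
  "clique E C \<longleftrightarrow> (\<forall>u\<in>C. \<forall>v\<in>C. u \<noteq> v \<longrightarrow> {u, v} \<in> E)"

text \<open>Only the vertex set varies: \<open>E\<close> stays fixed and \<open>V\<close> names an
  induced subgraph, so sampling or deleting vertices never changes \<open>E\<close>.\<close>

definition cliques :: "'a set set \<Rightarrow> nat \<Rightarrow> 'a set \<Rightarrow> 'a set set" where
  "cliques E s V = {C. C \<subseteq> V \<and> card C = s \<and> clique E C}"

definition nbrs :: "'a set set \<Rightarrow> 'a \<Rightarrow> 'a set \<Rightarrow> 'a set" where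
  "nbrs E u V = {w \<in> V. w \<noteq> u \<and> {u, w} \<in> E}"

text \<open>The clique polynomial of a weighted graph. For \<open>E = UNIV\<close> every set is a
  clique, and this is the elementary symmetric function of degree \<open>s\<close>; with all weights
  one it counts cliques.\<close>

definition clique_sum :: "'a set set \<Rightarrow> nat \<Rightarrow> 'a set \<Rightarrow> ('a \<Rightarrow> real) \<Rightarrow> real" where
  "clique_sum E s V x = (\<Sum>C\<in>cliques E s V. \<Prod>v\<in>C. x v)"

lemma finite_cliques: "finite V \<Longrightarrow> finite (cliques E s V)"
  by (rule finite_subset[of _ "Pow V"]) (auto simp: cliques_def)

lemma cliques_mono: "U \<subseteq> V \<Longrightarrow> cliques E s U \<subseteq> cliques E s V"
  by (auto simp: cliques_def)

lemma nbrs_subset: "nbrs E u V \<subseteq> V - {u}"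
  by (auto simp: nbrs_def)

lemma finite_nbrs: "finite V \<Longrightarrow> finite (nbrs E u V)"
  by (auto simp: nbrs_def)

lemma card_cliques_le_choose: "finite V \<Longrightarrow> card (cliques E s V) \<le> card V choose s"
  unfolding n_subsets[symmetric] by (intro card_mono) (auto simp: cliques_def)

lemma card_cliques_le_power: "finite V \<Longrightarrow> card (cliques E s V) \<le> card V ^ s"
  using card_cliques_le_choose[of V E s] binomial_le_pow[of s "card V"]
  by (cases "s \<le> card V") (auto simp: binomial_eq_0)

lemma cliques_Suc:
  assumes "finite V" "u \<in> V"
  shows "cliques E (Suc s) V = cliques E (Suc s) (V - {u}) \<union> insert u ` cliques E s (nbrs E u V)"
proof (intro equalityI subsetI)
  fix C assume C: "C \<in> cliques E (Suc s) V"
  then have fin: "finite C"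
    using assms(1) finite_subset by (auto simp: cliques_def)
  show "C \<in> cliques E (Suc s) (V - {u}) \<union> insert u ` cliques E s (nbrs E u V)"
  proof (cases "u \<in> C")
    case True
    then have "C - {u} \<in> cliques E s (nbrs E u V)"
      using C fin by (auto simp: cliques_def nbrs_def clique_def)
    then show ?thesis using True by (metis UnI2 image_eqI insert_Diff)
  qed (use C in \<open>auto simp: cliques_def\<close>)
next
  fix C assume "C \<in> cliques E (Suc s) (V - {u}) \<union> insert u ` cliques E s (nbrs E u V)"
  then show "C \<in> cliques E (Suc s) V"
  proof
    assume "C \<in> insert u ` cliques E s (nbrs E u V)"
    then obtain D where D: "C = insert u D" "D \<in> cliques E s (nbrs E u V)" by auto
    then have "finite D" "u \<notin> D"
      using finite_subset[of D V] assms(1) by (auto simp: cliques_def nbrs_def)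
    then show ?thesis
      using D assms(2) by (auto simp: cliques_def nbrs_def clique_def insert_commute)
  qed (auto simp: cliques_def)
qed

lemma inj_on_insert_cliques: "inj_on (insert u) (cliques E s (nbrs E u V))"
  using nbrs_subset[of E u V] by (intro inj_onI) (auto simp: cliques_def insert_ident)

text \<open>Splitting cliques by whether they contain \<open>u\<close> shows that the sum is affine
  in \<open>x u\<close>, with the clique sum of the neighbourhood as coefficient. Every transfer of
  weight below rests on this.\<close>

lemma clique_sum_Suc:
  assumes "finite V" "u \<in> V"
  shows "clique_sum E (Suc s) V x =
    clique_sum E (Suc s) (V - {u}) x + x u * clique_sum E s (nbrs E u V) x"
proof -
  have dis: "cliques E (Suc s) (V - {u}) \<inter> insert u ` cliques E s (nbrs E u V) = {}"
    by (auto simp: cliques_def)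
  have "(\<Prod>v\<in>insert u D. x v) = x u * (\<Prod>v\<in>D. x v)" if "D \<in> cliques E s (nbrs E u V)" for D
    using that assms(1) finite_subset[of D V] by (subst prod.insert) (auto simp: cliques_def nbrs_def)
  then show ?thesis
    unfolding clique_sum_def cliques_Suc[OF assms]
    by (subst sum.union_disjoint)
      (use dis assms in \<open>auto intro!: finite_imageI finite_cliques finite_nbrs
        simp: sum.reindex[OF inj_on_insert_cliques] sum_distrib_left\<close>)
qed

lemma clique_sum_0: "finite V \<Longrightarrow> clique_sum E 0 V x = 1"
proof -
  assume "finite V"
  then have "C \<in> cliques E 0 V \<longleftrightarrow> C = {}" for C
    using finite_subset[of C V] by (auto simp: cliques_def clique_def)
  then have "cliques E 0 V = {{}}" by blast
  then show ?thesis by (simp add: clique_sum_def)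
qed

lemma clique_sum_1: "clique_sum E 1 V x = sum x V"
proof -
  have "cliques E 1 V = (\<lambda>v. {v}) ` V"
    by (auto simp: cliques_def clique_def card_1_singleton_iff)
  then show ?thesis by (simp add: clique_sum_def sum.reindex)
qed

lemma clique_sum_nonneg: "(\<And>v. v \<in> V \<Longrightarrow> 0 \<le> x v) \<Longrightarrow> 0 \<le> clique_sum E s V x"
  unfolding clique_sum_def by (intro sum_nonneg prod_nonneg) (auto simp: cliques_def)

lemma clique_sum_mono:
  "finite V \<Longrightarrow> U \<subseteq> V \<Longrightarrow> (\<And>v. v \<in> V \<Longrightarrow> 0 \<le> x v) \<Longrightarrow>
    clique_sum E s U x \<le> clique_sum E s V x"
  unfolding clique_sum_def
  by (intro sum_mono2 finite_cliques cliques_mono prod_nonneg) (auto simp: cliques_def)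

lemma clique_sum_cong:
  "(\<And>v. v \<in> V \<Longrightarrow> x v = y v) \<Longrightarrow> clique_sum E s V x = clique_sum E s V y"
  unfolding clique_sum_def by (intro sum.cong refl prod.cong) (auto simp: cliques_def)

lemma clique_sum_one: "clique_sum E s V (\<lambda>_. 1) = card (cliques E s V)"
  by (simp add: clique_sum_def)

text \<open>Covers the degenerate vertices in the symmetrisation: a neighbourhood of total weight
  zero contributes to no clique sum of positive degree.\<close>

lemma clique_sum_eq_0:
  assumes "finite V" "s \<ge> 1" "sum x V = 0" "\<And>v. v \<in> V \<Longrightarrow> 0 \<le> x v"
  shows "clique_sum E s V x = 0"
proof -
  have z: "x v = 0" if "v \<in> V" for v
    using assms that sum_nonneg_eq_0_iff[of V x] by blast
  have "(\<Prod>v\<in>C. x v) = 0" if "C \<in> cliques E s V" for C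
  proof -
    have "C \<subseteq> V" "C \<noteq> {}" "finite C"
      using that assms(1,2) finite_subset by (auto simp: cliques_def)
    then show ?thesis using z by (metis all_not_in_conv prod_zero_iff subsetD)
  qed
  then show ?thesis by (simp add: clique_sum_def)
qed

section \<open>Elementary symmetric functions, as clique sums over \<open>UNIV\<close>\<close>

lemma nbrs_UNIV: "nbrs UNIV u V = V - {u}"
  by (auto simp: nbrs_def)

lemma clique_sum_clique:
  "clique E V \<Longrightarrow> clique_sum E s V x = clique_sum UNIV s V x"
proof -
  assume "clique E V"
  then have "cliques E s V = cliques UNIV s V"
    by (auto simp: cliques_def clique_def)
  then show ?thesis by (simp add: clique_sum_def)
qed

lemma card_cliques_UNIV: "finite V \<Longrightarrow> card (cliques UNIV s V) = card V choose s"
  using n_subsets[of V s] by (simp add: cliques_def clique_def)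

lemma clique_sum_UNIV_const:
  fixes z :: real
  assumes "finite V" "\<And>v. v \<in> V \<Longrightarrow> x v = z"
  shows "clique_sum UNIV s V x = real (card V choose s) * z ^ s"
proof -
  have "(\<Prod>v\<in>C. x v) = z ^ s" if "C \<in> cliques UNIV s V" for C
    using that assms by (auto simp: cliques_def subset_iff)
  then show ?thesis using assms by (simp add: clique_sum_def card_cliques_UNIV)
qed

lemma clique_sum_UNIV_pair:
  assumes "finite V" "u \<in> V" "v \<in> V" "u \<noteq> v"
  shows "clique_sum UNIV (Suc (Suc s)) V x =
    clique_sum UNIV (Suc (Suc s)) (V - {u, v}) x
    + (x u + x v) * clique_sum UNIV (Suc s) (V - {u, v}) x
    + x u * x v * clique_sum UNIV s (V - {u, v}) x"
proof -
  have "V - {u} - {v} = V - {u, v}" by auto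
  then show ?thesis
    using assms by (simp add: clique_sum_Suc[of V u] clique_sum_Suc[of "V - {u}" v] nbrs_UNIV
        algebra_simps)
qed

text \<open>Expanding the product on the right produces every squarefree monomial of degree
  \<open>s + 1\<close>. It gives the sign of the bracket in the smoothing step of Maclaurin's
  inequality.\<close>

lemma clique_sum_UNIV_Suc_le:
  assumes "finite V" "\<And>v. v \<in> V \<Longrightarrow> 0 \<le> x v"
  shows "clique_sum UNIV (Suc s) V x \<le> sum x V * clique_sum UNIV s V x"
  using assms
proof (induction V)
  case empty
  have "cliques UNIV (Suc s) {} = ({}::'a set set)" by (auto simp: cliques_def)
  then show ?case by (simp add: clique_sum_def)
next
  case (insert u V)
  have IH: "clique_sum UNIV (Suc s) V x \<le> sum x V * clique_sum UNIV s V x"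
    using insert by auto
  have "clique_sum UNIV (Suc s) (insert u V) x
      = clique_sum UNIV (Suc s) V x + x u * clique_sum UNIV s V x"
    using insert clique_sum_Suc[of "insert u V" u UNIV s x] by (simp add: nbrs_UNIV)
  also have "\<dots> \<le> sum x (insert u V) * clique_sum UNIV s V x"
    using IH insert by (simp add: algebra_simps)
  also have "\<dots> \<le> sum x (insert u V) * clique_sum UNIV s (insert u V) x"
    using insert by (intro mult_left_mono clique_sum_mono sum_nonneg) auto
  finally show ?case .
qed

text \<open>Strictness comes from one monomial through \<open>u\<close> whose other factors are
  positive for \<open>y\<close>. It is used to show that weights not all equal to \<open>z\<close>,
  but with the same second function, lie on both sides of \<open>z\<close>.\<close>

lemma clique_sum_UNIV_less:
  assumes "finite V" "u \<in> V" "s \<ge> 2" "s \<le> card V"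
    and "\<And>v. v \<in> V \<Longrightarrow> 0 \<le> x v \<and> x v \<le> y v" "x u < y u" "\<And>v. v \<in> V \<Longrightarrow> 0 < y v"
  shows "clique_sum UNIV s V x < clique_sum UNIV s V y"
proof -
  have le: "(\<Prod>v\<in>C. x v) \<le> (\<Prod>v\<in>C. y v)" if "C \<in> cliques UNIV s V" for C
    using that assms by (intro prod_mono) (auto simp: cliques_def)
  have "\<exists>C. C \<subseteq> V - {u} \<and> card C = s - 1"
  proof -
    have "s - 1 \<le> card (V - {u})" using assms(1,2,4) by (simp add: diff_le_mono)
    then obtain D where "D \<subseteq> V - {u}" "card D = s - 1"
      by (rule obtain_subset_with_card_n) blast
    then show ?thesis by blast
  qed
  then obtain D where D: "D \<subseteq> V - {u}" "card D = s - 1" by auto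
  have fD: "finite D" "u \<notin> D" using D assms(1) finite_subset[of D V] by auto
  have C: "insert u D \<in> cliques UNIV s V"
    using D fD assms by (auto simp: cliques_def clique_def)
  have "(\<Prod>v\<in>insert u D. x v) = x u * (\<Prod>v\<in>D. x v)" using fD by simp
  also have "\<dots> \<le> x u * (\<Prod>v\<in>D. y v)"
    using D assms by (intro mult_left_mono prod_mono) auto
  also have "\<dots> < y u * (\<Prod>v\<in>D. y v)"
    using D assms by (intro mult_strict_right_mono prod_pos) auto
  also have "\<dots> = (\<Prod>v\<in>insert u D. y v)" using fD by simp
  finally show ?thesis
    unfolding clique_sum_def using le C assms(1)
    by (intro sum_strict_mono_ex1 finite_cliques) auto
qed

text \<open>If a coordinate lies below the common value \<open>z\<close> and another one above it, then one of the two
  can be moved to \<open>z\<close> while the other is adjusted so as to keep the second elementary symmetric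
  function; this decreases the sum of the two and does not decrease the \<open>s\<close>-th function.\<close>

lemma clique_sum_UNIV_maclaurin:
  fixes z :: real
  assumes "finite V" "2 \<le> card V" "2 \<le> s" "\<And>v. v \<in> V \<Longrightarrow> 0 \<le> x v" "0 \<le> z"
    and "clique_sum UNIV 2 V x = real (card V choose 2) * z\<^sup>2"
  shows "clique_sum UNIV s V x \<le> real (card V choose s) * z ^ s"
  using assms
proof (induction "card {v \<in> V. x v \<noteq> z}" arbitrary: x rule: less_induct)
  case (less x)
  obtain s' where s': "s = Suc (Suc s')" using \<open>2 \<le> s\<close>
    by (metis add_2_eq_Suc le_Suc_ex)
  show ?case
  proof (cases "\<forall>v\<in>V. x v = z")
    case True
    then show ?thesis using clique_sum_UNIV_const[of V x z s] less by simp
  next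
    case False
    have const: "clique_sum UNIV 2 V (\<lambda>_. z) = clique_sum UNIV 2 V x"
      using less.prems clique_sum_UNIV_const[of V "\<lambda>_. z" z 2] by simp
    show ?thesis
    proof (cases "z = 0")
      case True
      \<comment> \<open>All pairs have product zero, and every set of size \<open>s\<close> contains
        a pair.\<close>
      have "clique_sum UNIV 2 V x = 0" using less.prems True by simp
      then have z0: "(\<Prod>v\<in>C. x v) = 0" if "C \<in> cliques UNIV 2 V" for C
      proof -
        have "(\<Prod>v\<in>D. x v) \<ge> 0" if "D \<in> cliques UNIV 2 V" for D
          using that less.prems(4) by (intro prod_nonneg) (auto simp: cliques_def)
        then show ?thesis
          using \<open>clique_sum UNIV 2 V x = 0\<close> that less.prems(1)
            sum_nonneg_eq_0_iff[of "cliques UNIV 2 V" "\<lambda>C. \<Prod>v\<in>C. x v"]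
          by (simp add: clique_sum_def finite_cliques)
      qed
      have "(\<Prod>v\<in>C. x v) = 0" if C: "C \<in> cliques UNIV s V" for C
      proof -
        have fC: "finite C" "C \<subseteq> V" "card C = s"
          using C less.prems finite_subset by (auto simp: cliques_def)
        then obtain D where D: "D \<subseteq> C" "card D = 2"
          using less.prems(3) obtain_subset_with_card_n by metis
        then have "(\<Prod>v\<in>D. x v) = 0"
          using fC by (intro z0) (auto simp: cliques_def clique_def)
        then show ?thesis using D fC by (metis prod_zero_iff finite_subset subsetD)
      qed
      then show ?thesis using True less.prems by (simp add: clique_sum_def)
    next
      case z: False
      then have zpos: "z > 0" using less.prems by simp
      obtain w where w: "w \<in> V" "x w \<noteq> z" using False by auto
      have "\<exists>u\<in>V. x u < z"
      proof (rule ccontr)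
        assume "\<not> ?thesis"
        then have ge: "z \<le> x v" if "v \<in> V" for v
          using that by (meson not_le)
        then have "z < x w" using w by (metis order_less_le)
        then have "clique_sum UNIV 2 V (\<lambda>_. z) < clique_sum UNIV 2 V x"
          using clique_sum_UNIV_less[of V w 2 "\<lambda>_. z" x] ge less.prems(1,2) w(1) zpos
          by (auto intro: less_le_trans)
        then show False using const by simp
      qed
      then obtain u where u: "u \<in> V" "x u < z" by auto
      have "\<exists>v\<in>V. x v > z"
      proof (rule ccontr)
        assume "\<not> ?thesis"
        then have ge: "x v \<le> z" if "v \<in> V" for v
          using that by (meson not_le)
        then have "clique_sum UNIV 2 V x < clique_sum UNIV 2 V (\<lambda>_. z)"
          using clique_sum_UNIV_less[of V u 2 x "\<lambda>_. z"] less.prems(1,2,4) u zpos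
          by auto
        then show False using const by simp
      qed
      then obtain v where v: "v \<in> V" "x v > z" by auto
      have uv: "u \<noteq> v" using u v by auto
      define V' where "V' = V - {u, v}"
      define B where "B = sum x V'"
      have V': "finite V'" "V' \<subseteq> V" "u \<notin> V'" "v \<notin> V'" using less.prems by (auto simp: V'_def)
      have B: "B \<ge> 0" using less.prems V' by (auto simp: B_def intro!: sum_nonneg)
      have xu: "x u \<ge> 0" using less.prems u by auto
      \<comment> \<open>The second function depends on the pair through
        \<open>x u * x v + (x u + x v) * B\<close>, that is, through
        \<open>(x u + B) * (x v + B)\<close>. Keeping this product when \<open>x u\<close> becomes
        \<open>z\<close> determines \<open>y\<close>.\<close>
      define y where "y = (x u + B) * (x v + B) / (z + B) - B"
      have yB: "(z + B) * (y + B) = (x u + B) * (x v + B)"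
        using zpos B by (simp add: y_def)
      have ylow: "y \<ge> x u"
      proof -
        have "(z + B) * (x u + B) \<le> (x v + B) * (x u + B)"
          using v xu B by (intro mult_right_mono) auto
        then have "(z + B) * (x u + B) \<le> (z + B) * (y + B)"
          using yB by (simp add: mult.commute)
        then show ?thesis using zpos B by simp
      qed
      have sum_le: "z + y \<le> x u + x v"
      proof -
        have "(z + B) * (x u + x v - z - y) = (z - x u) * (x v - z)"
          using yB by (simp add: algebra_simps)
        also have "\<dots> \<ge> 0" using u v by simp
        finally show ?thesis using zpos B by (simp add: zero_le_mult_iff)
      qed
      have prod_eq: "z * y = x u * x v + B * (x u + x v - z - y)"
        using yB by (simp add: algebra_simps)
      define x' where "x' = x(u := z, v := y)"
      have x'V: "clique_sum UNIV j V' x' = clique_sum UNIV j V' x" for j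
        using V' by (intro clique_sum_cong) (auto simp: x'_def)
      have x'uv: "x' u = z" "x' v = y" using uv by (auto simp: x'_def)
      have dec: "clique_sum UNIV (Suc (Suc j)) V w = clique_sum UNIV (Suc (Suc j)) V' w
          + (w u + w v) * clique_sum UNIV (Suc j) V' w + w u * w v * clique_sum UNIV j V' w" for j w
        using clique_sum_UNIV_pair[of V u v j w] less.prems u v uv by (simp add: V'_def)
      \<comment> \<open>The product of the pair gains exactly \<open>B\<close> times what its sum
        loses, so both changes share a factor. For \<open>j = 0\<close> the bracket is
        \<open>B - B\<close>, and in general it is nonnegative.\<close>
      have change: "clique_sum UNIV (Suc (Suc j)) V x' = clique_sum UNIV (Suc (Suc j)) V x
          + (x u + x v - z - y) * (B * clique_sum UNIV j V' x - clique_sum UNIV (Suc j) V' x)" for j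
        unfolding dec x'V x'uv prod_eq by (simp add: algebra_simps)
      have two: "clique_sum UNIV 2 V x' = clique_sum UNIV 2 V x"
        using change[of 0] clique_sum_0[OF V'(1)] clique_sum_1[of UNIV V' x]
        by (simp add: B_def numeral_2_eq_2)
      have grow: "clique_sum UNIV s V x' \<ge> clique_sum UNIV s V x"
        using change[of s'] clique_sum_UNIV_Suc_le[of V' x s'] V' less.prems sum_le
        by (simp add: s' B_def subset_iff)
      \<comment> \<open>The coordinate \<open>u\<close> now equals \<open>z\<close>, while
        \<open>v\<close> already differed from \<open>z\<close>, so the measure drops whatever
        \<open>y\<close> is.\<close>
      have "card {w \<in> V. x' w \<noteq> z} < card {w \<in> V. x w \<noteq> z}"
        using less.prems u v uv by (intro psubset_card_mono) (auto simp: x'_def)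
      then have "clique_sum UNIV s V x' \<le> real (card V choose s) * z ^ s"
        using less.prems ylow xu two by (intro less.hyps) (auto simp: x'_def)
      then show ?thesis using grow by simp
    qed
  qed
qed

section \<open>From complete graphs to clique-free graphs\<close>

lemma clique_sum_support:
  assumes "finite V" "U \<subseteq> V" "\<And>v. v \<in> V - U \<Longrightarrow> x v = 0"
  shows "clique_sum E s V x = clique_sum E s U x"
  unfolding clique_sum_def
proof (rule sum.mono_neutral_right)
  show "\<forall>C\<in>cliques E s V - cliques E s U. prod x C = 0"
  proof
    fix C assume C: "C \<in> cliques E s V - cliques E s U"
    then obtain v where "v \<in> C" "v \<in> V - U" by (auto simp: cliques_def)
    moreover have "finite C" using C assms(1) finite_subset[of C V] by (auto simp: cliques_def)
    ultimately show "prod x C = 0" using assms(3) by (metis prod_zero)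
  qed
qed (use assms in \<open>auto intro: finite_cliques cliques_mono[THEN subsetD]\<close>)

text \<open>Pad \<open>k\<close> weights equal to \<open>y\<close> with \<open>r - k\<close> zeros
  and apply Maclaurin's inequality on \<open>r\<close> points. This compares a clique on fewer than
  \<open>r\<close> vertices with one on exactly \<open>r\<close>.\<close>

lemma choose_power_mono:
  fixes y z :: real
  assumes "2 \<le> r" "k \<le> r" "2 \<le> s" "0 \<le> y" "0 \<le> z"
    and "real (k choose 2) * y\<^sup>2 = real (r choose 2) * z\<^sup>2"
  shows "real (k choose s) * y ^ s \<le> real (r choose s) * z ^ s"
proof -
  have *: "clique_sum UNIV j {..<r} (\<lambda>i. if i < k then y else 0) = real (k choose j) * y ^ j" for j
    using clique_sum_support[of "{..<r}" "{..<k}" "\<lambda>i. if i < k then y else 0" UNIV j] assms(2)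
      clique_sum_UNIV_const[of "{..<k}" "\<lambda>i. if i < k then y else 0" y j] by simp
  show ?thesis
    using clique_sum_UNIV_maclaurin[of "{..<r}" s "\<lambda>i. if i < k then y else 0" z] assms
    by (simp add: *)
qed

text \<open>For a non-adjacent pair \<open>u\<close>, \<open>v\<close> all clique sums are linear in \<open>(x u, x v)\<close>, so weight can be
  moved from one of the two to the other along a line on which the edge sum is constant.\<close>

lemma clique_sum_le_choose:
  fixes z :: real
  assumes "finite V" "\<And>C. C \<subseteq> V \<Longrightarrow> clique E C \<Longrightarrow> card C \<le> r" "2 \<le> r" "2 \<le> s"
    and "\<And>v. v \<in> V \<Longrightarrow> 0 \<le> x v" "0 \<le> z"
    and "clique_sum E 2 V x = real (r choose 2) * z\<^sup>2"
  shows "clique_sum E s V x \<le> real (r choose s) * z ^ s"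
  using assms
proof (induction "card V" arbitrary: V x rule: less_induct)
  case (less V x)
  obtain s' where s': "s = Suc s'" "s' \<ge> 1" using \<open>2 \<le> s\<close>
    by (intro that[of "s - 1"]) auto
  show ?case
  proof (cases "clique E V")
    case True
    define k where "k = card V"
    have k: "k \<le> r" using less.prems(2)[OF order_refl True] by (simp add: k_def)
    show ?thesis
    proof (cases "k < 2")
      case True
      then have "cliques E s V = {}"
        using card_cliques_le_choose[of V E s] finite_cliques[of V E s] less.prems(1,4)
        by (simp add: k_def binomial_eq_0)
      then show ?thesis using less.prems by (simp add: clique_sum_def)
    next
      case False
      \<comment> \<open>The common weight that gives \<open>k\<close> vertices the same edge
        sum.\<close>
      define y where "y = sqrt (clique_sum UNIV 2 V x / real (k choose 2))"
      have "real (k choose 2) > 0" using False by simp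
      moreover have "clique_sum UNIV 2 V x \<ge> 0" using less.prems by (intro clique_sum_nonneg) auto
      ultimately have y: "real (k choose 2) * y\<^sup>2 = clique_sum UNIV 2 V x" "y \<ge> 0"
        by (auto simp: y_def)
      have "clique_sum UNIV s V x \<le> real (k choose s) * y ^ s"
        using clique_sum_UNIV_maclaurin[of V s x y] less.prems False y by (simp add: k_def)
      also have "\<dots> \<le> real (r choose s) * z ^ s"
        using less.prems k y clique_sum_clique[OF True, of 2 x] by (intro choose_power_mono) auto
      finally show ?thesis by (simp add: clique_sum_clique[OF True])
    qed
  next
    case False
    \<comment> \<open>The coefficient of \<open>x u\<close> in the clique sum of degree
      \<open>j + 1\<close>.\<close>
    define b where "b u j = clique_sum E j (nbrs E u V) x" for u j
    have b0: "b u j \<ge> 0" for u j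
      unfolding b_def using less.prems(5) by (intro clique_sum_nonneg) (auto simp: nbrs_def)
    have b1: "b u s' = 0" if "b u 1 = 0" for u
      unfolding b_def
    proof (rule clique_sum_eq_0)
      show "sum x (nbrs E u V) = 0" using that by (simp add: b_def clique_sum_1 del: One_nat_def)
      show "0 \<le> x v" if "v \<in> nbrs E u V" for v
        using that less.prems(5) by (auto simp: nbrs_def)
    qed (use less.prems(1) s' finite_nbrs in auto)
    \<comment> \<open>Delete \<open>v\<close> and pass its weight to \<open>u\<close> at the
      exchange rate \<open>b v 1 / b u 1\<close>, which preserves the edge sum. The second
      alternative in \<open>cond\<close> compares the gain per unit of edge sum, so one of the two
      orders of the pair satisfies it when both rates are positive. If \<open>b v 1 = 0\<close>,
      then \<open>v\<close> lies in no clique of positive weight and nothing is moved.\<close>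
    have merge: ?thesis if uv: "u \<in> V" "v \<in> V" "u \<noteq> v" "{u, v} \<notin> E"
      and cond: "b v 1 = 0 \<or> (b u 1 > 0 \<and> b v s' * b u 1 \<le> b u s' * b v 1)" for u v
    proof -
      define x' where "x' = x(u := x u + x v * b v 1 / b u 1)"
      have x': "x' w = x w" if "w \<noteq> u" for w using that by (simp add: x'_def)
      have nb: "nbrs E v V \<subseteq> V - {u, v}" "nbrs E u V \<subseteq> V - {u, v}"
        "nbrs E u (V - {v}) = nbrs E u V"
        using uv by (auto simp: nbrs_def insert_commute)
      have V: "V - {v} - {u} = V - {u, v}" by auto
      have e: "clique_sum E (Suc j) V x =
          clique_sum E (Suc j) (V - {u, v}) x + x u * b u j + x v * b v j" for j
        using clique_sum_Suc[of V v E j x] clique_sum_Suc[of "V - {v}" u E j x] uv less.prems(1) nb V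
        by (simp add: b_def)
      have e': "clique_sum E (Suc j) (V - {v}) x' =
          clique_sum E (Suc j) (V - {u, v}) x + x' u * b u j" for j
      proof -
        have "clique_sum E j (nbrs E u V) x' = b u j"
          unfolding b_def using nb by (intro clique_sum_cong x') auto
        moreover have "clique_sum E (Suc j) (V - {u, v}) x' = clique_sum E (Suc j) (V - {u, v}) x"
          by (intro clique_sum_cong x') auto
        ultimately show ?thesis
          using clique_sum_Suc[of "V - {v}" u E j x'] uv less.prems(1) nb V by simp
      qed
      have "clique_sum E (Suc 1) (V - {v}) x' = clique_sum E (Suc 1) V x"
        unfolding e e' using cond by (auto simp: x'_def field_simps)
      then have two: "clique_sum E 2 (V - {v}) x' = real (r choose 2) * z\<^sup>2"
        using less.prems(7) by (simp add: numeral_2_eq_2)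
      have "x v * b v s' \<le> x v * b v 1 / b u 1 * b u s'"
      proof (cases "b v 1 = 0")
        case False
        then have "b v s' \<le> b v 1 / b u 1 * b u s'"
          using cond by (simp add: field_simps)
        then have "x v * b v s' \<le> x v * (b v 1 / b u 1 * b u s')"
          using less.prems(5) uv by (intro mult_left_mono) auto
        then show ?thesis by simp
      qed (simp add: b1)
      then have "clique_sum E s V x \<le> clique_sum E s (V - {v}) x'"
        unfolding s' e e' by (simp add: x'_def algebra_simps)
      also have "\<dots> \<le> real (r choose s) * z ^ s"
      proof (rule less.hyps)
        show "card (V - {v}) < card V" using uv less.prems(1) by (intro card_Diff1_less)
        show "0 \<le> x' w" if "w \<in> V - {v}" for w
          using that less.prems(5) uv b0 by (auto simp: x'_def intro!: add_nonneg_nonneg)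
      qed (use less.prems two in auto)
      finally show ?thesis .
    qed
    obtain u v where uv: "u \<in> V" "v \<in> V" "u \<noteq> v" "{u, v} \<notin> E"
      using False by (auto simp: clique_def)
    have vu: "v \<noteq> u" "{v, u} \<notin> E" using uv by (auto simp: insert_commute)
    consider "b v 1 = 0" | "b u 1 = 0" | "b u 1 > 0" "b v 1 > 0"
      using b0[of u 1] b0[of v 1] by linarith
    then show ?thesis
    proof cases
      case 3
      then show ?thesis
        using merge[OF uv] merge[OF uv(2,1) vu] by (metis mult.commute linear)
    qed (use merge[OF uv] merge[OF uv(2,1) vu] in auto)
  qed
qed

text \<open>All weights are one and \<open>z\<close> is solved from the edge count. Balanced
  complete \<open>r\<close>-partite graphs attain equality.\<close>

lemma card_cliques_le_of_clique_free:
  assumes "finite V" "cliques E (Suc r) V = {}" "2 \<le> r" "2 \<le> s"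
  shows "real (card (cliques E s V))
    \<le> real (r choose s) * sqrt (real (card (cliques E 2 V)) / real (r choose 2)) ^ s"
proof -
  have "card C \<le> r" if "C \<subseteq> V" "clique E C" for C
  proof (rule ccontr)
    assume "\<not> card C \<le> r"
    then obtain D where "D \<subseteq> C" "card D = Suc r"
      using obtain_subset_with_card_n[of "Suc r" C] by auto
    then have "D \<in> cliques E (Suc r) V" using that by (auto simp: cliques_def clique_def)
    then show False using assms by simp
  qed
  moreover have "real (r choose 2) > 0" using assms by simp
  ultimately show ?thesis
    using clique_sum_le_choose[of V E r s "\<lambda>_. 1"
        "sqrt (real (card (cliques E 2 V)) / real (r choose 2))"] assms
    by (simp add: clique_sum_one)
qed

section \<open>Random vertex subsets\<close>

lemma card_superset_subsets:
  assumes "finite W" "C \<subseteq> W" "card C \<le> k"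
  shows "card {S. S \<subseteq> W \<and> card S = k \<and> C \<subseteq> S} = (card W - card C) choose (k - card C)"
proof -
  have fC: "finite C" using assms finite_subset by auto
  have "bij_betw (\<lambda>S. S - C) {S. S \<subseteq> W \<and> card S = k \<and> C \<subseteq> S}
      {T. T \<subseteq> W - C \<and> card T = k - card C}"
  proof (rule bij_betwI[where g = "\<lambda>T. T \<union> C"])
    show "(\<lambda>T. T \<union> C) \<in> {T. T \<subseteq> W - C \<and> card T = k - card C} \<rightarrow>
        {S. S \<subseteq> W \<and> card S = k \<and> C \<subseteq> S}"
    proof
      fix T assume T: "T \<in> {T. T \<subseteq> W - C \<and> card T = k - card C}"
      then have "card (T \<union> C) = card T + card C"
        using assms(1) fC finite_subset[of T W] by (intro card_Un_disjoint) auto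
      then show "T \<union> C \<in> {S. S \<subseteq> W \<and> card S = k \<and> C \<subseteq> S}"
        using T assms by auto
    qed
  qed (use fC assms in \<open>auto simp: card_Diff_subset\<close>)
  then show ?thesis
    using bij_betw_same_card n_subsets[of "W - C" "k - card C"] assms fC
    by (fastforce simp: card_Diff_subset)
qed

text \<open>For \<open>j \<le> k \<le> n\<close>, the probability that a uniform
  \<open>k\<close>-subset of an \<open>n\<close>-set contains a given \<open>j\<close>-set.\<close>

definition sub_prob :: "nat \<Rightarrow> nat \<Rightarrow> nat \<Rightarrow> real" where
  "sub_prob n k j = real ((n - j) choose (k - j)) / real (n choose k)"

lemma sub_prob_0: "k \<le> n \<Longrightarrow> sub_prob n k 0 = 1"
  by (simp add: sub_prob_def)

lemma sub_prob_Suc: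
  assumes "j < k" "k \<le> n"
  shows "sub_prob n k (Suc j) = sub_prob n k j * (real (k - j) / real (n - j))"
proof -
  have "(k - j) * ((n - j) choose (k - j)) = (n - j) * ((n - Suc j) choose (k - Suc j))"
    using assms Suc_times_binomial_eq[of "n - Suc j" "k - Suc j"]
    by (simp add: Suc_diff_Suc mult.commute)
  then have "real (k - j) * real ((n - j) choose (k - j))
      = real (n - j) * real ((n - Suc j) choose (k - Suc j))"
    by (metis of_nat_mult)
  then have "real ((n - Suc j) choose (k - Suc j))
      = real ((n - j) choose (k - j)) * (real (k - j) / real (n - j))"
    using assms by (simp add: nonzero_eq_divide_eq mult.commute del: of_nat_diff)
  then show ?thesis
    by (simp add: sub_prob_def)
qed

lemma sub_prob_nonneg: "0 \<le> sub_prob n k j"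
  by (simp add: sub_prob_def)

lemma ratio_le:
  assumes "i \<le> j" "j < k" "k \<le> n"
  shows "real (k - j) / real (n - j) \<le> real (k - i) / real (n - i)"
proof -
  have "(real k - j) * (real n - i) \<le> (real k - i) * (real n - j)"
  proof -
    have "(real k - i) * (real n - j) - (real k - j) * (real n - i) = (real n - k) * (real j - i)"
      by (simp add: algebra_simps)
    moreover have "\<dots> \<ge> 0" using assms by simp
    ultimately show ?thesis by simp
  qed
  then show ?thesis using assms by (simp add: of_nat_diff field_simps)
qed

lemma sub_prob_le:
  assumes "j \<le> k" "k \<le> n"
  shows "sub_prob n k j \<le> (real k / real n) ^ j"
  using assms
proof (induction j)
  case 0
  then show ?case by (simp add: sub_prob_0)
next
  case (Suc j)
  have "sub_prob n k j * (real (k - j) / real (n - j)) \<le> (real k / real n) ^ j * (real k / real n)"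
    using Suc ratio_le[of 0 j k n] by (intro mult_mono) (auto simp: sub_prob_nonneg)
  then have "sub_prob n k (Suc j) \<le> (real k / real n) ^ j * (real k / real n)"
    using Suc.prems by (subst sub_prob_Suc) auto
  then show ?case by (simp add: mult.commute)
qed

lemma sub_prob_ge:
  assumes "j \<le> s" "s \<le> k" "k \<le> n"
  shows "(real (k - s) / real n) ^ j \<le> sub_prob n k j"
  using assms
proof (induction j)
  case 0
  then show ?case by (simp add: sub_prob_0)
next
  case (Suc j)
  have "real (k - s) / real n \<le> real (k - j) / real (n - j)"
    using Suc.prems by (intro frac_le) auto
  then have "(real (k - s) / real n) ^ j * (real (k - s) / real n)
      \<le> sub_prob n k j * (real (k - j) / real (n - j))"
    using Suc by (intro mult_mono) (auto simp: sub_prob_nonneg)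
  then have "(real (k - s) / real n) ^ j * (real (k - s) / real n) \<le> sub_prob n k (Suc j)"
    using Suc.prems by (subst sub_prob_Suc) auto
  then show ?case by (simp add: mult.commute)
qed

text \<open>Negative correlation: in sampling without replacement, two disjoint pairs are jointly
  included at most as often as if they were independent. Hence disjoint edges add nothing positive
  to the variance.\<close>

lemma sub_prob_4:
  assumes "4 \<le> k" "k \<le> n"
  shows "sub_prob n k 4 \<le> (sub_prob n k 2)\<^sup>2"
proof -
  have 2: "sub_prob n k 2 = real (k - 0) / real (n - 0) * (real (k - 1) / real (n - 1))"
    using sub_prob_Suc[of 0 k n] sub_prob_Suc[of 1 k n] assms by (simp add: sub_prob_0 numeral_2_eq_2)
  have "sub_prob n k 4 = sub_prob n k 2 * (real (k - 2) / real (n - 2)) * (real (k - 3) / real (n - 3))"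
    using sub_prob_Suc[of 2 k n] sub_prob_Suc[of 3 k n] assms
    by (simp add: numeral_eq_Suc)
  also have "\<dots> = sub_prob n k 2 * ((real (k - 2) / real (n - 2)) * (real (k - 3) / real (n - 3)))"
    by simp
  also have "\<dots> \<le> sub_prob n k 2 * sub_prob n k 2"
    unfolding 2 using ratio_le[of 0 2 k n] ratio_le[of 1 3 k n] assms
    by (intro mult_left_mono mult_mono) auto
  finally show ?thesis by (simp add: power2_eq_square)
qed

section \<open>First and second moments over random subsets\<close>

lemma sum_card_cliques_subsets:
  assumes "finite W" "j \<le> k" "k \<le> card W"
  shows "(\<Sum>S | S \<subseteq> W \<and> card S = k. real (card (cliques E j S)))
    = real (card W choose k) * (real (card (cliques E j W)) * sub_prob (card W) k j)"
proof -
  have fS: "finite {S. S \<subseteq> W \<and> card S = k}" using assms(1) by simp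
  have "real (card (cliques E j S)) = (\<Sum>C\<in>cliques E j W. if C \<subseteq> S then 1 else 0)"
    if "S \<subseteq> W" for S
  proof -
    have "cliques E j S = {C \<in> cliques E j W. C \<subseteq> S}" using that by (auto simp: cliques_def)
    then show ?thesis using finite_cliques[OF assms(1)] by (simp add: sum.If_cases Int_def)
  qed
  then have "(\<Sum>S | S \<subseteq> W \<and> card S = k. real (card (cliques E j S)))
      = (\<Sum>S | S \<subseteq> W \<and> card S = k. \<Sum>C\<in>cliques E j W. if C \<subseteq> S then 1 else 0)"
    by (intro sum.cong) auto
  also have "\<dots> = (\<Sum>C\<in>cliques E j W. \<Sum>S | S \<subseteq> W \<and> card S = k. if C \<subseteq> S then 1 else 0)"
    by (rule sum.swap)
  also have "\<dots> = (\<Sum>C\<in>cliques E j W. real ((card W - j) choose (k - j)))"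
  proof (intro sum.cong refl)
    fix C assume C: "C \<in> cliques E j W"
    have "{S. S \<subseteq> W \<and> card S = k} \<inter> {S. C \<subseteq> S} = {S. S \<subseteq> W \<and> card S = k \<and> C \<subseteq> S}" by auto
    then show "(\<Sum>S | S \<subseteq> W \<and> card S = k. if C \<subseteq> S then 1 else 0)
        = real ((card W - j) choose (k - j))"
      using card_superset_subsets[of W C k] C assms fS by (simp add: sum.If_cases cliques_def)
  qed
  finally show ?thesis using assms by (simp add: sub_prob_def)
qed

lemma card_cliques_2_le: "finite W \<Longrightarrow> 2 * real (card (cliques E 2 W)) \<le> (real (card W))\<^sup>2"
proof -
  assume W: "finite W"
  have "2 * card (cliques E 2 W) \<le> 2 * (card W choose 2)"
    using card_cliques_le_choose[OF W, of E 2] by simp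
  also have "\<dots> \<le> (card W)\<^sup>2"
    by (simp add: choose_two power2_eq_square algebra_simps)
  finally show ?thesis by (metis of_nat_le_iff of_nat_mult of_nat_numeral of_nat_power)
qed

lemma card_intersecting_pairs:
  assumes "finite W" "card e = 2"
  shows "card {f \<in> cliques E 2 W. e \<inter> f \<noteq> {}} \<le> 2 * card W"
proof -
  have fe: "finite e" using assms(2) card.infinite by fastforce
  have "{f \<in> cliques E 2 W. e \<inter> f \<noteq> {}} \<subseteq> (\<lambda>(a, w). {a, w}) ` (e \<times> W)"
  proof
    fix f assume f: "f \<in> {f \<in> cliques E 2 W. e \<inter> f \<noteq> {}}"
    then obtain a where a: "a \<in> e" "a \<in> f" by auto
    obtain b c where "f = {b, c}" using f by (auto simp: cliques_def card_2_iff)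
    then obtain w where "f = {a, w}" using a by auto
    then show "f \<in> (\<lambda>(a, w). {a, w}) ` (e \<times> W)" using a f by (auto simp: cliques_def)
  qed
  then have "card {f \<in> cliques E 2 W. e \<inter> f \<noteq> {}} \<le> card ((\<lambda>(a, w). {a, w}) ` (e \<times> W))"
    using assms(1) fe by (intro card_mono) auto
  also have "\<dots> \<le> card (e \<times> W)" using assms(1) fe by (intro card_image_le) auto
  finally show ?thesis using assms(2) by (simp add: card_cartesian_product)
qed

text \<open>Expand the square over ordered pairs of edges. Disjoint pairs are bounded by the squared
  mean. With \<open>n = card W\<close>, pairs that meet number at most \<open>2 * n * m\<close> and
  contribute at most \<open>k ^ 3\<close>, since \<open>2 * m \<le> n\<^sup>2\<close>; equal pairs
  contribute at most \<open>k\<^sup>2\<close>, again below \<open>k ^ 3\<close>.\<close>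

lemma sum_card_edges_sq_subsets:
  fixes W :: "'a set" and E
  assumes "finite W" "4 \<le> k" "k \<le> card W"
  defines "m \<equiv> real (card (cliques E 2 W))"
  shows "(\<Sum>S | S \<subseteq> W \<and> card S = k. (real (card (cliques E 2 S)))\<^sup>2)
    \<le> real (card W choose k) * ((m * sub_prob (card W) k 2)\<^sup>2 + 2 * real k ^ 3)"
proof -
  define n where "n = card W"
  define N where "N = real (n choose k)"
  define M where "M = cliques E 2 W"
  define p where "p = sub_prob n k"
  have n0: "n > 0" "k \<le> n" using assms by (auto simp: n_def)
  have N: "N > 0" using n0 by (simp add: N_def)
  have fM: "finite M" using assms finite_cliques by (auto simp: M_def)
  have fS: "finite {S. S \<subseteq> W \<and> card S = k}" using assms(1) by simp
  have M: "f \<subseteq> W \<and> card f = 2 \<and> finite f" if "f \<in> M" for f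
    using that assms(1) finite_subset by (auto simp: M_def cliques_def)
  have cnt: "(\<Sum>S | S \<subseteq> W \<and> card S = k. if e \<union> f \<subseteq> S then 1 else 0) = N * p (card (e \<union> f))"
    if "e \<in> M" "f \<in> M" for e f
  proof -
    have "card (e \<union> f) \<le> 4" using M[OF that(1)] M[OF that(2)] card_Un_le[of e f] by simp
    moreover have "{S. S \<subseteq> W \<and> card S = k} \<inter> {S. e \<union> f \<subseteq> S}
        = {S. S \<subseteq> W \<and> card S = k \<and> e \<union> f \<subseteq> S}" by auto
    ultimately show ?thesis
      using card_superset_subsets[of W "e \<union> f" k] assms M[OF that(1)] M[OF that(2)] fS N
      by (simp add: sum.If_cases p_def sub_prob_def n_def[symmetric] N_def)
  qed
  have sq: "(real (card (cliques E 2 S)))\<^sup>2 = (\<Sum>e\<in>M. \<Sum>f\<in>M. if e \<union> f \<subseteq> S then 1 else 0)"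
    if "S \<subseteq> W" for S
  proof -
    have "cliques E 2 S = {C \<in> M. C \<subseteq> S}" using that by (auto simp: cliques_def M_def)
    then have "real (card (cliques E 2 S)) = (\<Sum>e\<in>M. if e \<subseteq> S then 1 else 0)"
      using fM by (simp add: sum.If_cases Int_def)
    then show ?thesis
      by (auto simp: power2_eq_square sum_product intro!: sum.cong)
  qed
  have "(\<Sum>S | S \<subseteq> W \<and> card S = k. (real (card (cliques E 2 S)))\<^sup>2)
      = (\<Sum>S | S \<subseteq> W \<and> card S = k. \<Sum>e\<in>M. \<Sum>f\<in>M. if e \<union> f \<subseteq> S then 1 else 0)"
    by (intro sum.cong) (auto simp: sq)
  also have "\<dots> = (\<Sum>e\<in>M. \<Sum>f\<in>M. \<Sum>S | S \<subseteq> W \<and> card S = k. if e \<union> f \<subseteq> S then 1 else 0)"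
    by (subst sum.swap, rule sum.cong[OF refl], rule sum.swap)
  also have "\<dots> = (\<Sum>e\<in>M. \<Sum>f\<in>M. N * p (card (e \<union> f)))"
    by (intro sum.cong refl cnt)
  also have "\<dots> \<le> (\<Sum>e\<in>M. N * (m * p 4 + 2 * real n * p 3 + p 2))"
  proof (intro sum_mono)
    fix e assume e: "e \<in> M"
    \<comment> \<open>One term for each size of the intersection; \<open>p 4\<close> is charged to
      every \<open>f\<close>, so that its total is simply \<open>m * p 4\<close>.\<close>
    have bound: "p (card (e \<union> f)) \<le> p 4 + (if e \<inter> f \<noteq> {} then p 3 else 0) + (if f = e then p 2 else 0)"
      if f: "f \<in> M" for f
    proof (cases "e \<inter> f = {}")
      case True
      then show ?thesis using M[OF e] M[OF f] by (auto simp: card_Un_disjoint p_def sub_prob_nonneg)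
    next
      case False
      have "card (e \<union> f) + card (e \<inter> f) = 4"
        using M[OF e] M[OF f] card_Un_Int[of e f] by simp
      moreover have "card (e \<inter> f) \<ge> 1" using False M[OF e] by (simp add: Suc_le_eq card_gt_0_iff)
      moreover have "card (e \<inter> f) \<le> 2" using M[OF e] card_mono[of e "e \<inter> f"] by simp
      moreover have "f = e" if "card (e \<inter> f) = 2"
        using that M[OF e] M[OF f] card_subset_eq[of e "e \<inter> f"] card_subset_eq[of f "e \<inter> f"] by auto
      ultimately consider "card (e \<union> f) = 3" | "card (e \<union> f) = 2" "f = e" by linarith
      then show ?thesis
        using False by cases (auto simp: p_def sub_prob_nonneg add_nonneg_nonneg)
    qed
    have "(\<Sum>f\<in>M. N * p (card (e \<union> f)))
        \<le> (\<Sum>f\<in>M. N * (p 4 + (if e \<inter> f \<noteq> {} then p 3 else 0) + (if f = e then p 2 else 0)))"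
      using N by (intro sum_mono mult_left_mono bound) auto
    also have "\<dots> = N * (m * p 4 + real (card {f \<in> M. e \<inter> f \<noteq> {}}) * p 3 + p 2)"
    proof -
      have "(\<Sum>f\<in>M. if e \<inter> f \<noteq> {} then p 3 else 0) = real (card {f \<in> M. e \<inter> f \<noteq> {}}) * p 3"
        using fM by (simp add: sum.inter_filter[symmetric])
      moreover have "(\<Sum>f\<in>M. if f = e then p 2 else 0) = p 2"
        using fM e by simp
      ultimately show ?thesis
        by (simp only: sum_distrib_left[symmetric] sum.distrib) (simp add: m_def M_def)
    qed
    also have "\<dots> \<le> N * (m * p 4 + 2 * real n * p 3 + p 2)"
    proof -
      have "real (card {f \<in> M. e \<inter> f \<noteq> {}}) \<le> 2 * real n"
        using card_intersecting_pairs[of W e E] assms(1) M[OF e]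
        by (metis M_def n_def of_nat_le_iff of_nat_mult of_nat_numeral)
      then show ?thesis using N
        by (intro mult_left_mono add_mono mult_right_mono order_refl) (auto simp: p_def sub_prob_nonneg)
    qed
    finally show "(\<Sum>f\<in>M. N * p (card (e \<union> f))) \<le> N * (m * p 4 + 2 * real n * p 3 + p 2)" .
  qed
  also have "\<dots> = N * (m\<^sup>2 * p 4 + (2 * m) * (real n * p 3) + m * p 2)"
    by (simp add: m_def M_def power2_eq_square algebra_simps)
  also have "\<dots> \<le> N * ((m * p 2)\<^sup>2 + 2 * real k ^ 3)"
  proof (intro mult_left_mono)
    have "m\<^sup>2 * p 4 \<le> m\<^sup>2 * (p 2)\<^sup>2"
      using sub_prob_4[of k n] assms n0 by (intro mult_left_mono) (auto simp: p_def)
    moreover have m2: "2 * m \<le> (real n)\<^sup>2" using card_cliques_2_le[OF assms(1)] by (simp add: m_def n_def)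
    have "0 \<le> m" by (simp add: m_def)
    with m2 have m0: "0 \<le> m" "m \<le> (real n)\<^sup>2" by linarith+
    have "(2 * m) * (real n * p 3) \<le> (real n)\<^sup>2 * (real n * (real k / real n) ^ 3)"
      using sub_prob_le[of 3 k n] assms(2) n0 m2 m0 sub_prob_nonneg[of n k]
      by (intro mult_mono mult_left_mono) (auto simp: p_def)
    moreover have "(real n)\<^sup>2 * (real n * (real k / real n) ^ 3) = real k ^ 3"
      using n0 by (simp add: field_simps power2_eq_square power3_eq_cube)
    moreover have "m * p 2 \<le> (real n)\<^sup>2 * (real k / real n)\<^sup>2"
      using sub_prob_le[of 2 k n] assms(2) n0 m0 sub_prob_nonneg[of n k]
      by (intro mult_mono) (auto simp: p_def)
    moreover have "(real n)\<^sup>2 * (real k / real n)\<^sup>2 = (real k)\<^sup>2"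
      using n0 by (simp add: field_simps)
    moreover have "(real k)\<^sup>2 \<le> real k ^ 3"
      using assms by (intro power_increasing) auto
    ultimately show "m\<^sup>2 * p 4 + (2 * m) * (real n * p 3) + m * p 2 \<le> (m * p 2)\<^sup>2 + 2 * real k ^ 3"
      by (simp add: power_mult_distrib)
  qed (use N in auto)
  finally show ?thesis by (simp add: N_def n_def p_def)
qed

text \<open>Meant for square roots of edge counts: it replaces a convex power by a bound linear in
  the deviation of the counts. For \<open>p > u\<close>, combine
  \<open>p ^ s - u ^ s \<le> s * p ^ (s - 1) * (p - u)\<close> with
  \<open>p * (p - u) \<le> p\<^sup>2 - u\<^sup>2\<close>.\<close>

lemma power_diff_le_square_diff:
  fixes p u b :: real
  assumes "0 \<le> p" "0 \<le> u" "p \<le> b" "2 \<le> s"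
  shows "p ^ s \<le> u ^ s + real s * b ^ (s - 2) * \<bar>p\<^sup>2 - u\<^sup>2\<bar>"
proof (cases "p \<le> u")
  case True
  then have "p ^ s \<le> u ^ s" using assms by (intro power_mono) auto
  moreover have "0 \<le> real s * b ^ (s - 2) * \<bar>p\<^sup>2 - u\<^sup>2\<bar>" using assms by auto
  ultimately show ?thesis by linarith
next
  case False
  have step: "p ^ Suc j \<le> u ^ Suc j + real (Suc j) * p ^ j * (p - u)" for j
  proof (induction j)
    case (Suc j)
    have "p ^ Suc (Suc j) \<le> p * (u ^ Suc j + real (Suc j) * p ^ j * (p - u))"
      using mult_left_mono[OF Suc assms(1)] by simp
    also have "\<dots> = u ^ Suc (Suc j) + u ^ Suc j * (p - u) + real (Suc j) * p ^ Suc j * (p - u)"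
      by (simp add: algebra_simps)
    also have "\<dots> \<le> u ^ Suc (Suc j) + p ^ Suc j * (p - u) + real (Suc j) * p ^ Suc j * (p - u)"
      using False assms by (intro add_mono mult_right_mono power_mono) auto
    also have "\<dots> = u ^ Suc (Suc j) + real (Suc (Suc j)) * p ^ Suc j * (p - u)"
      by (simp add: algebra_simps)
    finally show ?case .
  qed simp
  obtain j where j: "s = Suc (Suc j)" using assms(4) by (metis add_2_eq_Suc le_Suc_ex)
  have "p ^ s \<le> u ^ s + real s * p ^ j * (p * (p - u))"
    using step[of "Suc j"] by (simp add: j mult_ac)
  also have "\<dots> \<le> u ^ s + real s * b ^ j * \<bar>p\<^sup>2 - u\<^sup>2\<bar>"
  proof (intro add_left_mono mult_mono)
    have "p * (p - u) \<le> (p + u) * (p - u)" using False assms by (intro mult_right_mono) auto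
    also have "\<dots> = p\<^sup>2 - u\<^sup>2" by (simp add: power2_eq_square algebra_simps)
    finally show "p * (p - u) \<le> \<bar>p\<^sup>2 - u\<^sup>2\<bar>" by linarith
  qed (use False assms in \<open>auto intro: power_mono\<close>)
  finally show ?thesis by (simp add: j)
qed

lemma sum_abs_edge_deviation:
  assumes "finite W" "4 \<le> l\<^sup>2" "l\<^sup>2 \<le> card W"
  shows "(\<Sum>S | S \<subseteq> W \<and> card S = l\<^sup>2.
      \<bar>real (card (cliques E 2 S)) - real (card (cliques E 2 W)) * sub_prob (card W) (l\<^sup>2) 2\<bar>)
    \<le> real (card W choose l\<^sup>2) * (2 * real l ^ 3)"
proof -
  define \<mu> where "\<mu> = real (card (cliques E 2 W)) * sub_prob (card W) (l\<^sup>2) 2"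
  define N where "N = real (card W choose l\<^sup>2)"
  define P where "P S = real (card (cliques E 2 S))" for S
  let ?\<S> = "{S. S \<subseteq> W \<and> card S = l\<^sup>2}"
  have cS: "real (card ?\<S>) = N" using assms(1) by (simp add: n_subsets N_def)
  have l: "real l > 0" using assms(2) by (cases l) auto
  have "(\<Sum>S\<in>?\<S>. (P S - \<mu>)\<^sup>2) = (\<Sum>S\<in>?\<S>. (P S)\<^sup>2) - 2 * \<mu> * (\<Sum>S\<in>?\<S>. P S) + N * \<mu>\<^sup>2"
    by (simp add: power2_diff sum.distrib sum_subtractf sum_distrib_left cS mult_ac)
  also have "\<dots> \<le> N * (\<mu>\<^sup>2 + 2 * real (l\<^sup>2) ^ 3) - 2 * \<mu> * (N * \<mu>) + N * \<mu>\<^sup>2"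
    using sum_card_edges_sq_subsets[OF assms, of E] sum_card_cliques_subsets[of W 2 "l\<^sup>2" E] assms
    by (simp add: P_def \<mu>_def N_def)
  also have "\<dots> = N * (2 * real l ^ 6)"
    by (simp add: algebra_simps power2_eq_square flip: power_mult)
  finally have var: "(\<Sum>S\<in>?\<S>. (P S - \<mu>)\<^sup>2) \<le> N * (2 * real l ^ 6)" .
  \<comment> \<open>Plays the part of the Cauchy-Schwarz inequality. The weight \<open>l ^ 3\<close>
    is the order of the standard deviation, because the variance is at most
    \<open>2 * l ^ 6\<close>.\<close>
  have amgm: "\<bar>y\<bar> \<le> (y\<^sup>2 / real l ^ 3 + real l ^ 3) / 2" for y :: real
  proof -
    define L where "L = real l ^ 3"
    have L: "L > 0" using l by (simp add: L_def)
    have "0 \<le> (\<bar>y\<bar> - L)\<^sup>2" by simp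
    also have "\<dots> = y\<^sup>2 + L * L - 2 * (\<bar>y\<bar> * L)"
      by (simp add: power2_diff power2_eq_square[of L])
    finally have "2 * (\<bar>y\<bar> * L) \<le> y\<^sup>2 + L * L" by simp
    then have "(2 * \<bar>y\<bar>) * L \<le> (y\<^sup>2 / L + L) * L"
      using L by (simp add: distrib_right)
    then show ?thesis using L by (simp add: L_def)
  qed
  have "(\<Sum>S\<in>?\<S>. \<bar>P S - \<mu>\<bar>) \<le> (\<Sum>S\<in>?\<S>. ((P S - \<mu>)\<^sup>2 / real l ^ 3 + real l ^ 3) / 2)"
    by (intro sum_mono amgm)
  also have "\<dots> = ((\<Sum>S\<in>?\<S>. (P S - \<mu>)\<^sup>2) / real l ^ 3 + N * real l ^ 3) / 2"
    by (simp add: sum_divide_distrib[symmetric] sum.distrib cS)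
  also have "\<dots> \<le> (N * (2 * real l ^ 6) / real l ^ 3 + N * real l ^ 3) / 2"
    using var l by (intro divide_right_mono add_mono) auto
  also have "\<dots> = N * (3 / 2 * real l ^ 3)"
    using l by (simp add: field_simps flip: power_add)
  also have "\<dots> \<le> N * (2 * real l ^ 3)" using l by (intro mult_left_mono) (auto simp: N_def)
  finally show ?thesis by (simp add: P_def \<mu>_def N_def)
qed

text \<open>Averaging the bound for clique-free graphs over all subsets of a fixed size \<open>l\<^sup>2\<close>; the subsets
  that do contain a clique of size \<open>r + 1\<close> are few, and the variance of the number of edges in a
  random subset controls the passage to the power \<open>s / 2\<close>.\<close>

lemma card_cliques_le_supersaturated:
  fixes W :: "'a set" and E r s l
  assumes "finite W" "2 \<le> r" "2 \<le> s" "4 \<le> l\<^sup>2" "s \<le> l\<^sup>2" "r + 1 \<le> l\<^sup>2" "l\<^sup>2 \<le> card W"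
  defines "c \<equiv> real (r choose s) / sqrt (real (r choose 2)) ^ s"
    and "n \<equiv> real (card W)"
  shows "real (card (cliques E s W)) \<le> c * sqrt (real (card (cliques E 2 W))) ^ s
    + n ^ s * ((real s)\<^sup>2 / (real l)\<^sup>2 + 2 * c * real s / real l
      + real (l\<^sup>2) ^ (r + 1) * real (card (cliques E (r + 1) W)) / n ^ (r + 1))"
proof -
  define k where "k = l\<^sup>2"
  define p where "p = sub_prob (card W) k"
  define m where "m = real (card (cliques E 2 W))"
  define \<mu> where "\<mu> = m * p 2"
  define N where "N = real (card W choose k)"
  define K where "K j = real (card (cliques E j W))" for j
  define Q where "Q j S = real (card (cliques E j S))" for j S
  let ?\<S> = "{S. S \<subseteq> W \<and> card S = k}"
  have k: "4 \<le> k" "s \<le> k" "r + 1 \<le> k" "k \<le> card W" using assms by (auto simp: k_def)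
  have lk: "real l ^ 2 = real k" "real l > 0" using k(1) by (auto simp: k_def intro: gr0I)
  have npos: "n > 0" "real k > 0" "real k \<le> n" using k by (auto simp: n_def)
  have c0: "c \<ge> 0" by (simp add: c_def)
  have N: "N > 0" using k by (simp add: N_def)
  have p0: "0 \<le> p j" for j by (simp add: p_def sub_prob_nonneg)
  have pn: "p j \<le> (real k / n) ^ j" if "j \<le> k" for j
    unfolding p_def n_def using that k by (intro sub_prob_le)
  have m0: "0 \<le> m" by (simp add: m_def)
  have \<mu>0: "0 \<le> \<mu>" using m0 p0 by (simp add: \<mu>_def)
  have sqrt\<mu>: "sqrt \<mu> \<le> sqrt m * (real k / n)"
  proof -
    have "\<mu> \<le> m * (real k / n)\<^sup>2" using pn[of 2] k m0 by (auto simp: \<mu>_def intro: mult_left_mono)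
    then have "sqrt \<mu> \<le> sqrt (m * (real k / n)\<^sup>2)" by (rule real_sqrt_le_mono)
    then show ?thesis using npos by (simp add: real_sqrt_mult)
  qed
  \<comment> \<open>A subset containing an \<open>r + 1\<close>-clique gets the trivial bound
    \<open>k ^ s\<close>, charged to its cliques of that size, of which there is at least
    one.\<close>
  have point: "Q s S \<le> c * (sqrt \<mu> ^ s + real s * real k ^ (s - 2) * \<bar>Q 2 S - \<mu>\<bar>)
      + real k ^ s * Q (r + 1) S" if S: "S \<in> ?\<S>" for S
  proof (cases "cliques E (Suc r) S = {}")
    case True
    have fS: "finite S" using S assms(1) finite_subset by auto
    have "Q s S \<le> real (r choose s) * sqrt (Q 2 S / real (r choose 2)) ^ s"
      using card_cliques_le_of_clique_free[OF fS True assms(2,3)] by (simp add: Q_def)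
    also have "\<dots> = c * sqrt (Q 2 S) ^ s"
      by (simp add: c_def real_sqrt_divide power_divide)
    also have "\<dots> \<le> c * (sqrt \<mu> ^ s + real s * real k ^ (s - 2) * \<bar>(sqrt (Q 2 S))\<^sup>2 - (sqrt \<mu>)\<^sup>2\<bar>)"
    proof (intro mult_left_mono power_diff_le_square_diff c0 assms(3))
      have "Q 2 S \<ge> 0" by (simp add: Q_def)
      moreover have "2 * Q 2 S \<le> (real k)\<^sup>2"
        using card_cliques_2_le[OF fS, of E] S by (simp add: Q_def)
      ultimately have "Q 2 S \<le> (real k)\<^sup>2" by linarith
      then show "sqrt (Q 2 S) \<le> real k" by (simp add: real_le_lsqrt)
    qed (use \<mu>0 in \<open>auto simp: Q_def\<close>)
    also have "\<dots> \<le> c * (sqrt \<mu> ^ s + real s * real k ^ (s - 2) * \<bar>Q 2 S - \<mu>\<bar>)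
        + real k ^ s * Q (r + 1) S"
      using \<mu>0 by (simp add: Q_def)
    finally show ?thesis .
  next
    case False
    have fS: "finite S" using S assms(1) finite_subset by auto
    have "Q s S \<le> real k ^ s"
      using card_cliques_le_power[OF fS, of E s] S by (simp add: Q_def flip: of_nat_power)
    also have "\<dots> \<le> real k ^ s * Q (r + 1) S"
    proof -
      have "1 \<le> Q (r + 1) S"
        using False finite_cliques[OF fS] by (simp add: Q_def Suc_le_eq card_gt_0_iff)
      then show ?thesis using mult_left_mono[of 1 "Q (r + 1) S" "real k ^ s"] by simp
    qed
    also have "\<dots> \<le> c * (sqrt \<mu> ^ s + real s * real k ^ (s - 2) * \<bar>Q 2 S - \<mu>\<bar>)
        + real k ^ s * Q (r + 1) S"
      using c0 \<mu>0 by simp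
    finally show ?thesis .
  qed
  have mean: "(\<Sum>S\<in>?\<S>. Q j S) = N * (K j * p j)" if "j \<le> k" for j
    using sum_card_cliques_subsets[OF assms(1) that k(4), of E] by (simp add: Q_def N_def K_def p_def)
  have dev: "(\<Sum>S\<in>?\<S>. \<bar>Q 2 S - \<mu>\<bar>) \<le> N * (2 * real l ^ 3)"
    using sum_abs_edge_deviation[OF assms(1,4,7), of E]
    by (simp add: Q_def \<mu>_def m_def p_def k_def N_def)
  have cS: "real (card ?\<S>) = N" using assms(1) by (simp add: n_subsets N_def)
  have "N * (K s * p s) = (\<Sum>S\<in>?\<S>. Q s S)" using mean k by simp
  also have "\<dots> \<le> (\<Sum>S\<in>?\<S>. c * (sqrt \<mu> ^ s + real s * real k ^ (s - 2) * \<bar>Q 2 S - \<mu>\<bar>)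
      + real k ^ s * Q (r + 1) S)"
    by (intro sum_mono point)
  also have "\<dots> = c * (N * sqrt \<mu> ^ s + real s * real k ^ (s - 2) * (\<Sum>S\<in>?\<S>. \<bar>Q 2 S - \<mu>\<bar>))
      + real k ^ s * (\<Sum>S\<in>?\<S>. Q (r + 1) S)"
    by (simp add: sum.distrib sum_distrib_left[symmetric] cS)
  also have "\<dots> \<le> c * (N * (sqrt m * (real k / n)) ^ s + real s * real k ^ (s - 2) * (N * (2 * real l ^ 3)))
      + real k ^ s * (N * (K (r + 1) * (real k / n) ^ (r + 1)))"
    unfolding mean[OF k(3)] using dev c0 N \<mu>0 sqrt\<mu> pn[OF k(3)] p0
    by (intro add_mono mult_left_mono power_mono) (auto simp: K_def)
  also have "\<dots> = N * (c * (sqrt m * (real k / n)) ^ s + 2 * c * real s * (real k ^ (s - 2) * real l ^ 3)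
      + real k ^ s * (K (r + 1) * (real k / n) ^ (r + 1)))"
    by (simp add: algebra_simps)
  finally have avg: "K s * p s \<le> c * (sqrt m * (real k / n)) ^ s
      + 2 * c * real s * (real k ^ (s - 2) * real l ^ 3)
      + real k ^ s * (K (r + 1) * (real k / n) ^ (r + 1))"
    using N by simp
  define d where "d = (real k / n) ^ s"
  have d: "d > 0" using npos by (simp add: d_def)
  have dn: "real k ^ s = d * n ^ s" using npos by (simp add: d_def power_divide)
  \<comment> \<open>Here \<open>k\<^sup>2 = l ^ 4\<close>, so the deviation \<open>l ^ 3\<close>
    costs a fraction \<open>1 / l\<close> of \<open>k ^ s\<close>.\<close>
  have kl: "real k ^ (s - 2) * real l ^ 3 = d * n ^ s / real l"
  proof -
    have "real k ^ (s - 2) * real l ^ 3 * real l = real k ^ (s - 2) * real k ^ 2"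
      by (simp add: lk(1)[symmetric] power2_eq_square power3_eq_cube)
    also have "\<dots> = real k ^ s" using assms(3) by (metis le_add_diff_inverse2 power_add)
    finally show ?thesis using lk(2) by (simp add: dn field_simps)
  qed
  \<comment> \<open>Bernoulli's inequality gives \<open>p s\<close> up to a proportion
    \<open>s\<^sup>2 / k\<close>. The share of \<open>K s\<close> lost here is restored below
    through \<open>K s \<le> n ^ s\<close>.\<close>
  have "K s * (d * (1 - (real s)\<^sup>2 / real k)) \<le> K s * p s"
  proof (intro mult_left_mono)
    have "(1 - (real s)\<^sup>2 / real k) \<le> (1 - real s / real k) ^ s"
      using Bernoulli_inequality[of "- (real s / real k)" s] k npos
      by (simp add: power2_eq_square)
    then have "d * (1 - (real s)\<^sup>2 / real k) \<le> d * (1 - real s / real k) ^ s"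
      using d by (intro mult_left_mono) auto
    also have "\<dots> = (real (k - s) / n) ^ s"
      using k npos by (simp add: d_def of_nat_diff field_simps flip: power_mult_distrib)
    also have "\<dots> \<le> p s" unfolding p_def n_def using k by (intro sub_prob_ge) auto
    finally show "d * (1 - (real s)\<^sup>2 / real k) \<le> p s" .
  qed (simp add: K_def)
  also note avg
  also have "c * (sqrt m * (real k / n)) ^ s + 2 * c * real s * (real k ^ (s - 2) * real l ^ 3)
      + real k ^ s * (K (r + 1) * (real k / n) ^ (r + 1))
    = d * (c * sqrt m ^ s + n ^ s * (2 * c * real s / real l
      + real k ^ (r + 1) * K (r + 1) / n ^ (r + 1)))"
    unfolding kl dn power_mult_distrib[of "sqrt m"] d_def[symmetric]
    by (simp add: power_divide algebra_simps)
  finally have "d * (K s * (1 - (real s)\<^sup>2 / real k)) \<le> d * (c * sqrt m ^ s + n ^ s * (2 * c * real s / real l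
      + real k ^ (r + 1) * K (r + 1) / n ^ (r + 1)))"
    by (simp add: mult_ac)
  then have "K s * (1 - (real s)\<^sup>2 / real k) \<le> c * sqrt m ^ s + n ^ s * (2 * c * real s / real l
      + real k ^ (r + 1) * K (r + 1) / n ^ (r + 1))"
    using d by simp
  moreover have "K s * ((real s)\<^sup>2 / real k) \<le> n ^ s * ((real s)\<^sup>2 / real k)"
  proof (intro mult_right_mono)
    show "K s \<le> n ^ s"
      unfolding K_def n_def of_nat_power[symmetric] of_nat_le_iff
      by (rule card_cliques_le_power[OF assms(1)])
  qed simp
  ultimately have "K s \<le> c * sqrt m ^ s + n ^ s * ((real s)\<^sup>2 / real k + 2 * c * real s / real l
      + real k ^ (r + 1) * K (r + 1) / n ^ (r + 1))"
    unfolding distrib_left right_diff_distrib by linarith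
  then show ?thesis
    unfolding K_def m_def k_def of_nat_power[of l 2] .
qed

section \<open>Blowups from many cliques\<close>

text \<open>The induction removes one coordinate at a time: a dense relation has many tails \<open>xs\<close> with
  a linear number of heads, and averaging over the \<open>t\<close>-sets of heads finds one \<open>t\<close>-set that is
  common to a positive proportion of the tails.\<close>

lemma dense_relation_contains_box:
  fixes \<rho> :: real
  assumes "0 < \<rho>" "1 \<le> t"
  shows "\<exists>n\<^sub>0. \<forall>(W :: 'a set) g. finite W \<longrightarrow> n\<^sub>0 \<le> card W \<longrightarrow>
    \<rho> * real (card W) ^ q \<le> real (card {xs. length xs = q \<and> set xs \<subseteq> W \<and> g xs}) \<longrightarrow>
    (\<exists>Ys. length Ys = q \<and> (\<forall>Y\<in>set Ys. Y \<subseteq> W \<and> card Y = t) \<and>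
      (\<forall>xs. list_all2 (\<in>) xs Ys \<longrightarrow> g xs))"
  using assms(1)
proof (induction q arbitrary: \<rho>)
  case 0
  have "g []" if "\<rho> \<le> real (card {xs. xs = [] \<and> g xs})" for g :: "'a list \<Rightarrow> bool"
  proof (rule ccontr)
    assume "\<not> g []"
    then have "{xs. xs = [] \<and> g xs} = {}" by auto
    then have "card {xs. xs = [] \<and> g xs} = 0" by (simp only: card.empty)
    then show False using that 0 by linarith
  qed
  then show ?case by (auto cong: conj_cong)
next
  case (Suc q)
  \<comment> \<open>At least \<open>\<rho> / 2 * n ^ q\<close> tails have
    \<open>\<rho> / 2 * n\<close> heads or more. Each of these contains a proportion of at least
    \<open>(\<rho> / (2 * t)) ^ t\<close> of all \<open>t\<close>-sets, by
    \<open>(d / t) ^ t \<le> d choose t\<close> and \<open>n choose t \<le> n ^ t\<close>.\<close>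
  define \<rho>' where "\<rho>' = (\<rho> / 2) * (\<rho> / (2 * real t)) ^ t"
  have "\<rho>' > 0" using Suc.prems assms(2) by (simp add: \<rho>'_def)
  from Suc.IH[OF this] obtain n1 where n1: "\<And>(W :: 'a set) g. finite W \<Longrightarrow> n1 \<le> card W \<Longrightarrow>
    \<rho>' * real (card W) ^ q \<le> real (card {xs. length xs = q \<and> set xs \<subseteq> W \<and> g xs}) \<Longrightarrow>
    (\<exists>Ys. length Ys = q \<and> (\<forall>Y\<in>set Ys. Y \<subseteq> W \<and> card Y = t) \<and>
      (\<forall>xs. list_all2 (\<in>) xs Ys \<longrightarrow> g xs))"
    by blast
  \<comment> \<open>The last entry makes \<open>\<rho> / 2 * n\<close> at least \<open>t\<close>, so
    that a large head set does contain \<open>t\<close>-sets.\<close>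
  define n0 where "n0 = max n1 (max t (nat \<lceil>2 * real t / \<rho>\<rceil>))"
  have "\<exists>Ys. length Ys = Suc q \<and> (\<forall>Y\<in>set Ys. Y \<subseteq> W \<and> card Y = t) \<and>
      (\<forall>xs. list_all2 (\<in>) xs Ys \<longrightarrow> g xs)"
    if W: "finite W" "n0 \<le> card W"
      and dense: "\<rho> * real (card W) ^ Suc q
        \<le> real (card {xs. length xs = Suc q \<and> set xs \<subseteq> W \<and> g xs})"
    for W :: "'a set" and g
  proof -
    define n where "n = card W"
    have n: "n1 \<le> n" "t \<le> n" "2 * real t / \<rho> \<le> real n"
      using W(2) by (auto simp: n0_def n_def)
    have npos: "real n > 0" using n(2) assms(2) by simp
    have nt: "real t \<le> \<rho> / 2 * real n" using n(3) Suc.prems by (simp add: field_simps)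
    define X where "X = {xs. length xs = q \<and> set xs \<subseteq> W}"
    have X: "finite X" "card X = n ^ q"
      using W(1) finite_lists_length_eq[of W q] card_lists_length_eq[of W q]
      by (simp_all add: X_def n_def conj_commute)
    define d where "d xs = {y \<in> W. g (y # xs)}" for xs
    have d: "finite (d xs)" "card (d xs) \<le> n" for xs
      using W(1) by (auto simp: d_def n_def intro: card_mono)
    have "{xs. length xs = Suc q \<and> set xs \<subseteq> W \<and> g xs} = (\<lambda>(xs, y). y # xs) ` Sigma X d"
      by (auto simp: X_def d_def length_Suc_conv image_iff)
    moreover have "inj_on (\<lambda>(xs, y). y # xs) (Sigma X d)"
      by (auto simp: inj_on_def)
    ultimately have "card {xs. length xs = Suc q \<and> set xs \<subseteq> W \<and> g xs} = (\<Sum>xs\<in>X. card (d xs))"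
      using X d by (simp add: card_image)
    then have sum_d: "\<rho> * real n ^ Suc q \<le> (\<Sum>xs\<in>X. real (card (d xs)))"
      using dense by (simp add: n_def)
    define X' where "X' = {xs \<in> X. \<rho> / 2 * real n \<le> real (card (d xs))}"
    have X': "finite X'" "X' \<subseteq> X" using X by (auto simp: X'_def)
    have "(\<Sum>xs\<in>X. real (card (d xs))) \<le> (\<Sum>xs\<in>X. (if xs \<in> X' then real n else 0) + \<rho> / 2 * real n)"
    proof (intro sum_mono)
      fix xs assume "xs \<in> X"
      moreover have "real (card (d xs)) \<le> real n" "0 \<le> \<rho> / 2 * real n"
        using d(2) Suc.prems by auto
      ultimately show "real (card (d xs)) \<le> (if xs \<in> X' then real n else 0) + \<rho> / 2 * real n"
        by (auto simp: X'_def not_le)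
    qed
    also have "\<dots> = real (card X') * real n + real n ^ q * (\<rho> / 2 * real n)"
      using X X' by (simp add: sum.distrib sum.If_cases Int_absorb1 X(2) flip: Int_def)
    finally have "\<rho> / 2 * real n ^ q * real n \<le> real (card X') * real n"
      using sum_d by (simp add: algebra_simps)
    then have X'_card: "\<rho> / 2 * real n ^ q \<le> real (card X')"
      using npos by simp
    define \<T> where "\<T> = {T. T \<subseteq> W \<and> card T = t}"
    have \<T>: "finite \<T>" "card \<T> = n choose t" using W(1) by (simp_all add: \<T>_def n_def n_subsets)
    define B where "B = \<rho>' * real n ^ q"
    have many: "(\<rho> / (2 * real t)) ^ t * real (n choose t) \<le> real (card {T \<in> \<T>. T \<subseteq> d xs})"
      if "xs \<in> X'" for xs
    proof -
      have dx: "\<rho> / 2 * real n \<le> real (card (d xs))" using that by (simp add: X'_def)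
      then have "t \<le> card (d xs)" using nt by linarith
      have "{T \<in> \<T>. T \<subseteq> d xs} = {T. T \<subseteq> d xs \<and> card T = t}" by (auto simp: \<T>_def d_def)
      then have eq: "card {T \<in> \<T>. T \<subseteq> d xs} = card (d xs) choose t" using d by (simp add: n_subsets)
      have "(\<rho> / (2 * real t)) ^ t * real (n choose t) \<le> (\<rho> / (2 * real t)) ^ t * real n ^ t"
        using binomial_le_pow[OF n(2)] Suc.prems
        by (intro mult_left_mono) (auto simp flip: of_nat_power)
      also have "\<dots> = (\<rho> / 2 * real n / real t) ^ t"
        by (simp add: power_mult_distrib[symmetric])
      also have "\<dots> \<le> (real (card (d xs)) / real t) ^ t"
        using dx Suc.prems by (intro power_mono divide_right_mono) auto
      also have "\<dots> \<le> real (card (d xs) choose t)"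
        using binomial_ge_n_over_k_pow_k[OF \<open>t \<le> card (d xs)\<close>, where ?'a = real] by simp
      finally show ?thesis using eq by simp
    qed
    have "B * real (n choose t) = (\<rho> / 2 * real n ^ q) * ((\<rho> / (2 * real t)) ^ t * real (n choose t))"
      by (simp add: B_def \<rho>'_def)
    also have "\<dots> \<le> real (card X') * ((\<rho> / (2 * real t)) ^ t * real (n choose t))"
      using X'_card Suc.prems by (intro mult_right_mono) auto
    also have "\<dots> \<le> (\<Sum>xs\<in>X'. real (card {T \<in> \<T>. T \<subseteq> d xs}))"
      using sum_mono[OF many, of X' "\<lambda>x. x"] by simp
    also have "\<dots> = (\<Sum>xs\<in>X'. \<Sum>T\<in>\<T>. if T \<subseteq> d xs then 1 else 0)"
      using \<T> by (simp add: sum.If_cases Int_def)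
    also have "\<dots> = (\<Sum>T\<in>\<T>. \<Sum>xs\<in>X'. if T \<subseteq> d xs then 1 else 0)"
      by (rule sum.swap)
    also have "\<dots> = (\<Sum>T\<in>\<T>. real (card {xs \<in> X'. T \<subseteq> d xs}))"
      using X' by (simp add: sum.If_cases Int_def)
    finally have avg: "B * real (card \<T>) \<le> (\<Sum>T\<in>\<T>. real (card {xs \<in> X'. T \<subseteq> d xs}))"
      by (simp add: \<T>)
    have "\<exists>T\<in>\<T>. B \<le> real (card {xs \<in> X'. T \<subseteq> d xs})"
    proof (rule ccontr)
      assume "\<not> ?thesis"
      then have "(\<Sum>T\<in>\<T>. real (card {xs \<in> X'. T \<subseteq> d xs})) < (\<Sum>T\<in>\<T>. B)"
        using \<T> n(2) by (intro sum_strict_mono) (auto simp: not_le card_gt_0_iff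
            dest: arg_cong[of _ _ card])
      then show False using avg by (simp add: mult.commute)
    qed
    then obtain T where T: "T \<subseteq> W" "card T = t" "B \<le> real (card {xs \<in> X'. T \<subseteq> d xs})"
      by (auto simp: \<T>_def)
    define g' where "g' xs \<longleftrightarrow> (\<forall>y\<in>T. g (y # xs))" for xs
    have "card {xs \<in> X'. T \<subseteq> d xs} \<le> card {xs. length xs = q \<and> set xs \<subseteq> W \<and> g' xs}"
      using X(1) by (intro card_mono) (auto simp: X'_def X_def d_def g'_def conj_assoc
          intro: rev_finite_subset)
    then have "\<rho>' * real (card W) ^ q \<le> real (card {xs. length xs = q \<and> set xs \<subseteq> W \<and> g' xs})"
      using T(3) by (simp add: B_def n_def)
    from n1[OF W(1) n(1)[unfolded n_def] this] obtain Ys where Ys: "length Ys = q"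
      "\<forall>Y\<in>set Ys. Y \<subseteq> W \<and> card Y = t" "\<forall>xs. list_all2 (\<in>) xs Ys \<longrightarrow> g' xs"
      by blast
    show ?thesis
      using Ys T by (intro exI[of _ "T # Ys"]) (auto simp: list_all2_Cons2 g'_def)
  qed
  then show ?case by blast
qed

text \<open>Apply the box lemma to ordered tuples. Each clique has an ordering, so the relation is
  dense; requiring tuples to be distinct makes the sides of the box pairwise disjoint.\<close>

lemma many_cliques_imp_blowup:
  fixes \<rho> :: real
  assumes "0 < \<rho>" "1 \<le> t"
  shows "\<exists>n\<^sub>0. \<forall>(W :: 'a set) E. finite W \<longrightarrow> n\<^sub>0 \<le> card W \<longrightarrow>
    \<rho> * real (card W) ^ q \<le> real (card (cliques E q W)) \<longrightarrow>
    (\<exists>Y. (\<forall>i<q. Y i \<subseteq> W \<and> card (Y i) = t) \<and>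
      (\<forall>i<q. \<forall>j<q. i \<noteq> j \<longrightarrow> (\<forall>y\<in>Y i. \<forall>z\<in>Y j. y \<noteq> z \<and> {y, z} \<in> E)))"
proof -
  obtain n0 where n0: "\<And>(W :: 'a set) g. finite W \<Longrightarrow> n0 \<le> card W \<Longrightarrow>
    \<rho> * real (card W) ^ q \<le> real (card {xs. length xs = q \<and> set xs \<subseteq> W \<and> g xs}) \<Longrightarrow>
    (\<exists>Ys. length Ys = q \<and> (\<forall>Y\<in>set Ys. Y \<subseteq> W \<and> card Y = t) \<and>
      (\<forall>xs. list_all2 (\<in>) xs Ys \<longrightarrow> g xs))"
    using dense_relation_contains_box[OF assms, of q] by blast
  show ?thesis
  proof (intro exI[of _ n0] allI impI)
    fix W :: "'a set" and E
    assume W: "finite W" "n0 \<le> card W" and dense: "\<rho> * real (card W) ^ q \<le> real (card (cliques E q W))"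
    define g where "g xs \<longleftrightarrow> distinct xs \<and> clique E (set xs)" for xs :: "'a list"
    have "finite {xs. length xs = q \<and> set xs \<subseteq> W \<and> g xs}"
      by (rule rev_finite_subset[OF finite_lists_length_eq[OF W(1), of q]]) auto
    moreover have "cliques E q W \<subseteq> set ` {xs. length xs = q \<and> set xs \<subseteq> W \<and> g xs}"
    proof
      fix C assume C: "C \<in> cliques E q W"
      then have "finite C" using W(1) finite_subset by (auto simp: cliques_def)
      then obtain xs where "set xs = C" "distinct xs" using finite_distinct_list by metis
      then show "C \<in> set ` {xs. length xs = q \<and> set xs \<subseteq> W \<and> g xs}"
        using C by (auto simp: cliques_def g_def distinct_card intro!: image_eqI[of _ _ xs])
    qed
    ultimately have "card (cliques E q W) \<le> card {xs. length xs = q \<and> set xs \<subseteq> W \<and> g xs}"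
      by (rule surj_card_le)
    then have "\<rho> * real (card W) ^ q \<le> real (card {xs. length xs = q \<and> set xs \<subseteq> W \<and> g xs})"
      using dense by linarith
    from n0[OF W this] obtain Ys where Ys: "length Ys = q" "\<forall>Y\<in>set Ys. Y \<subseteq> W \<and> card Y = t"
      "\<forall>xs. list_all2 (\<in>) xs Ys \<longrightarrow> g xs"
      by blast
    have "y \<noteq> z \<and> {y, z} \<in> E"
      if ij: "i < q" "j < q" "i \<noteq> j" and yz: "y \<in> Ys ! i" "z \<in> Ys ! j" for i j y z
    proof -
      \<comment> \<open>Extend \<open>y\<close> and \<open>z\<close> to a full transversal of the
        box; the other sides are nonempty because \<open>t \<ge> 1\<close>.\<close>
      define f where "f k = (if k = i then y else if k = j then z else (SOME w. w \<in> Ys ! k))" for k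
      have "f k \<in> Ys ! k" if "k < q" for k
      proof -
        have "Ys ! k \<noteq> {}" using Ys(1,2) that assms(2) by (metis card.empty nth_mem not_one_le_zero)
        then show ?thesis using yz by (auto simp: f_def some_in_eq)
      qed
      then have "list_all2 (\<in>) (map f [0..<q]) Ys" using Ys(1) by (simp add: list_all2_conv_all_nth)
      then have *: "distinct (map f [0..<q])" "clique E (set (map f [0..<q]))"
        using Ys(3) by (auto simp: g_def)
      have "f i \<noteq> f j" using *(1) ij by (auto simp: distinct_map inj_on_def)
      moreover have "{f i, f j} \<in> E" using *(2) ij \<open>f i \<noteq> f j\<close> by (auto simp: clique_def)
      ultimately show ?thesis using ij by (simp add: f_def)
    qed
    then show "\<exists>Y. (\<forall>i<q. Y i \<subseteq> W \<and> card (Y i) = t) \<and>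
      (\<forall>i<q. \<forall>j<q. i \<noteq> j \<longrightarrow> (\<forall>y\<in>Y i. \<forall>z\<in>Y j. y \<noteq> z \<and> {y, z} \<in> E))"
      using Ys by (intro exI[of _ "\<lambda>i. Ys ! i"]) auto
  qed
qed

section \<open>Clique counts and Turan graphs\<close>

lemma clique_iff_nsets: "clique E C \<longleftrightarrow> [C]\<^bsup>2\<^esup> \<subseteq> E"
  by (auto simp: clique_def nsets_2_eq)

text \<open>A bijection carries all pairs to all pairs, so a copy is determined by its vertex set,
  and counting copies amounts to counting cliques.\<close>

lemma copies_complete_graph:
  assumes "simple_graph G"
  shows "copies (complete_graph s) G = (\<lambda>C. Graph C ([C]\<^bsup>2\<^esup>)) ` cliques (edges G) s (verts G)"
proof (intro equalityI subsetI)
  fix H assume "H \<in> copies (complete_graph s) G"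
  then have H: "subgraph H G" and "isomorphic (complete_graph s) H" by (auto simp: copies_def)
  then obtain f where f: "bij_betw f {..<s} (verts H)" "edges H = (\<lambda>e. f ` e) ` ([{..<s}]\<^bsup>2\<^esup>)"
    by (auto simp: isomorphic_def complete_graph_def)
  have "edges H = [verts H]\<^bsup>2\<^esup>"
    using bij_betw_nsets[OF f(1), of 2] f(2) by (simp add: bij_betw_def)
  moreover have "card (verts H) = s" using bij_betw_same_card[OF f(1)] by simp
  ultimately show "H \<in> (\<lambda>C. Graph C ([C]\<^bsup>2\<^esup>)) ` cliques (edges G) s (verts G)"
    using H by (intro image_eqI[of _ _ "verts H"])
      (auto simp: subgraph_def cliques_def clique_iff_nsets graph.expand)
next
  fix H assume "H \<in> (\<lambda>C. Graph C ([C]\<^bsup>2\<^esup>)) ` cliques (edges G) s (verts G)"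
  then obtain C where C: "C \<in> cliques (edges G) s (verts G)" "H = Graph C ([C]\<^bsup>2\<^esup>)" by auto
  have fC: "finite C" "card C = s"
    using C assms finite_subset by (auto simp: cliques_def simple_graph_def)
  then obtain f where f: "bij_betw f {..<s} C"
    using bij_betw_iff_card[of "{..<s}" C] by auto
  have "[C]\<^bsup>2\<^esup> = (\<lambda>e. f ` e) ` ([{..<s}]\<^bsup>2\<^esup>)"
    using bij_betw_nsets[OF f, of 2] by (simp add: bij_betw_def)
  then show "H \<in> copies (complete_graph s) G"
    using C fC f by (auto simp: copies_def simple_graph_def subgraph_def cliques_def
        clique_iff_nsets isomorphic_def complete_graph_def)
qed

lemma kappa_eq: "simple_graph G \<Longrightarrow> kappa s G = card (cliques (edges G) s (verts G))"
  unfolding kappa_def copies_complete_graph by (intro card_image inj_onI) auto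

lemma contains_complete_graph_iff:
  "simple_graph G \<Longrightarrow> contains G (complete_graph q) \<longleftrightarrow> cliques (edges G) q (verts G) \<noteq> {}"
  by (simp add: contains_def copies_complete_graph)

lemma edges_eq_cliques: "simple_graph G \<Longrightarrow> edges G = cliques (edges G) 2 (verts G)"
proof (intro equalityI subsetI)
  fix e assume G: "simple_graph G" and e: "e \<in> edges G"
  then have "e \<in> [verts G]\<^bsup>2\<^esup>" by (auto simp: simple_graph_def)
  then obtain u v where "e = {u, v}" "u \<in> verts G" "v \<in> verts G" "u \<noteq> v"
    by (auto elim: nsets2_E)
  then show "e \<in> cliques (edges G) 2 (verts G)"
    using e by (auto simp: cliques_def clique_def insert_commute)
next
  fix e assume "e \<in> cliques (edges G) 2 (verts G)"
  then obtain u v where "e = {u, v}" "u \<noteq> v" "clique (edges G) e"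
    by (auto simp: cliques_def card_2_iff)
  then show "e \<in> edges G" by (simp add: clique_def)
qed

lemma finite_edges: "simple_graph G \<Longrightarrow> finite (edges G)"
  using finite_subset[of "edges G" "[verts G]\<^bsup>2\<^esup>"] finite_imp_finite_nsets[of "verts G" 2]
  by (simp add: simple_graph_def)

text \<open>With at least two vertices, a clique is the union of its edges. The bound makes the set
  in \<open>mex\<close> finite, so that its \<open>Max\<close> is a genuine maximum even though host
  graphs may have any number of vertices.\<close>

lemma card_cliques_le_pow2_edges:
  assumes "finite E" "2 \<le> s"
  shows "card (cliques E s V) \<le> 2 ^ card E"
proof -
  have un: "C = \<Union>([C]\<^bsup>2\<^esup>)" if C: "C \<in> cliques E s V" for C
  proof -
    have "u \<in> \<Union>([C]\<^bsup>2\<^esup>)" if u: "u \<in> C" for u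
    proof -
      have "C \<noteq> {u}" using C assms(2) by (auto simp: cliques_def)
      then obtain v where "v \<in> C" "v \<noteq> u" using u by blast
      then have "{u, v} \<in> [C]\<^bsup>2\<^esup>" using u by simp
      then show ?thesis by blast
    qed
    then show ?thesis by (auto simp: nsets_def)
  qed
  have "inj_on (\<lambda>C. [C]\<^bsup>2\<^esup>) (cliques E s V)"
  proof (rule inj_onI)
    fix C D assume "C \<in> cliques E s V" "D \<in> cliques E s V" "[C]\<^bsup>2\<^esup> = [D]\<^bsup>2\<^esup>"
    then show "C = D" using un[of C] un[of D] by (simp only:)
  qed
  moreover have "(\<lambda>C. [C]\<^bsup>2\<^esup>) ` cliques E s V \<subseteq> Pow E"
    by (auto simp: cliques_def clique_iff_nsets)
  ultimately have "card (cliques E s V) \<le> card (Pow E)"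
    using assms(1) by (intro card_inj_on_le[of "\<lambda>C. [C]\<^bsup>2\<^esup>"]) auto
  then show ?thesis using assms(1) by (simp add: card_Pow)
qed

text \<open>\<open>mex\<close> asks for exactly \<open>m\<close> edges. Isolated extra edges reach
  any larger number, and they create no clique on three or more vertices.\<close>

lemma clique_free_add_edges:
  fixes G :: "nat graph"
  assumes "simple_graph G" "cliques (edges G) q (verts G) = {}" "3 \<le> q"
  shows "\<exists>G' :: nat graph. simple_graph G' \<and> card (edges G') = card (edges G) + d \<and>
    cliques (edges G') q (verts G') = {} \<and> kappa s G \<le> kappa s G'"
proof (induction d)
  case 0
  then show ?case using assms by auto
next
  case (Suc d)
  then obtain H :: "nat graph" where H: "simple_graph H" "card (edges H) = card (edges G) + d"
    "cliques (edges H) q (verts H) = {}" "kappa s G \<le> kappa s H" by blast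
  \<comment> \<open>Inserting 0 keeps \<open>Max\<close> meaningful when \<open>H\<close> has no
    vertices.\<close>
  define x where "x = Suc (Max (insert 0 (verts H)))"
  define y where "y = Suc x"
  have lt: "w < x" if "w \<in> verts H" for w
    unfolding x_def less_Suc_eq_le using H(1) that by (intro Max_ge) (simp_all add: simple_graph_def)
  have fresh: "x \<notin> verts H" "y \<notin> verts H" "x \<noteq> y"
    using lt[of x] lt[of y] by (auto simp: y_def)
  define H' where "H' = Graph (insert x (insert y (verts H))) (insert {x, y} (edges H))"
  have eH: "edges H \<subseteq> [verts H]\<^bsup>2\<^esup>" using H(1) by (simp add: simple_graph_def)
  then have no: "{x, w} \<notin> edges H" "{y, w} \<notin> edges H" for w using fresh by auto
  have s': "simple_graph H'"
    using H(1) fresh nsets_mono[of "verts H" "insert x (insert y (verts H))" 2]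
    by (auto simp: simple_graph_def H'_def)
  have "card (edges H') = card (edges G) + Suc d"
    using no(1)[of y] finite_edges[OF H(1)] H(2) by (simp add: H'_def)
  moreover have "cliques (edges H') q (verts H') = {}"
  proof (rule ccontr)
    assume "\<not> ?thesis"
    then obtain C where C: "C \<subseteq> verts H'" "card C = q" "clique (edges H') C"
      by (auto simp: cliques_def)
    have edge: "{u, v} = {x, y} \<or> {u, v} \<in> edges H" if "u \<in> C" "v \<in> C" "u \<noteq> v" for u v
      using C(3) that by (auto simp: clique_def H'_def)
    show False
    proof (cases "x \<in> C \<or> y \<in> C")
      case True
      then have "C \<subseteq> {x, y}" using edge no by (metis doubleton_eq_iff insertCI subsetI)
      then have "card C \<le> 2" using card_mono[of "{x, y}" C] fresh by simp
      then show False using C assms(3) by simp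
    next
      case False
      then have "C \<in> cliques (edges H) q (verts H)"
        using C edge by (auto simp: cliques_def clique_def H'_def doubleton_eq_iff)
      then show False using H(3) by simp
    qed
  qed
  moreover have "kappa s H \<le> kappa s H'"
    unfolding kappa_eq[OF H(1)] kappa_eq[OF s']
    using s' by (intro card_mono finite_cliques) (auto simp: simple_graph_def cliques_def clique_def H'_def)
  ultimately show ?case using s' H(4) by (intro exI[of _ H']) auto
qed

lemma kappa_le_mex:
  fixes G :: "nat graph"
  assumes "simple_graph G" "cliques (edges G) (r + 1) (verts G) = {}" "card (edges G) \<le> m"
    and "2 \<le> r" "2 \<le> s"
  shows "kappa s G \<le> mex (complete_graph s) m (complete_graph (r + 1))"
proof -
  let ?M = "{card (copies (complete_graph s) G) | G :: nat graph.
     simple_graph G \<and> card (edges G) = m \<and> \<not> contains G (complete_graph (r + 1))}"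
  obtain G' :: "nat graph" where G': "simple_graph G'" "card (edges G') = m"
    "cliques (edges G') (r + 1) (verts G') = {}" "kappa s G \<le> kappa s G'"
    using clique_free_add_edges[OF assms(1,2), of "m - card (edges G)" s] assms(3,4) by auto
  have "c \<le> 2 ^ m" if c: "c \<in> ?M" for c
  proof -
    from c obtain H :: "nat graph" where H: "simple_graph H" "card (edges H) = m" "c = kappa s H"
      by (auto simp: kappa_def)
    then show ?thesis
      using card_cliques_le_pow2_edges[OF finite_edges[OF H(1)] assms(5)] by (simp add: kappa_eq)
  qed
  then have "finite ?M" by (meson finite_nat_set_iff_bounded_le)
  moreover have "kappa s G' \<in> ?M"
    using G' by (auto simp: kappa_def contains_complete_graph_iff)
  ultimately have "kappa s G' \<le> Max ?M" by (rule Max_ge)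
  then show ?thesis using G'(4) by (simp add: mex_def)
qed

text \<open>An infinite complete \<open>r\<close>-partite graph whose parts are the residue classes;
  the vertices below \<open>r * a\<close> induce the balanced one with parts of size
  \<open>a\<close>.\<close>

definition turan_edges :: "nat \<Rightarrow> nat set set" where
  "turan_edges r = {{x, y} | x y. x mod r \<noteq> y mod r}"

lemma doubleton_in_turan_edges: "{x, y} \<in> turan_edges r \<longleftrightarrow> x mod r \<noteq> y mod r"
  by (auto simp: turan_edges_def doubleton_eq_iff)

text \<open>A clique picks \<open>s\<close> distinct residues and, for each residue
  \<open>i\<close>, one quotient \<open>f i < a\<close>, giving the vertex
  \<open>f i * r + i\<close>. Extensional functions make the pair \<open>(I, f)\<close>
  unique.\<close>

lemma card_cliques_turan_edges:
  assumes "1 \<le> r"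
  shows "card (cliques (turan_edges r) s {..<r * a}) = (r choose s) * a ^ s"
proof -
  let ?X = "{I. I \<subseteq> {..<r} \<and> card I = s}"
  let ?\<Phi> = "\<lambda>(I, f). (\<lambda>i. f i * r + i) ` I"
  let ?S = "Sigma ?X (\<lambda>I. I \<rightarrow>\<^sub>E {..<a})"
  have cl: "clique (turan_edges r) C \<longleftrightarrow> inj_on (\<lambda>x. x mod r) C" for C
    by (auto simp: clique_def doubleton_in_turan_edges inj_on_def)
  have md: "(f i * r + i) mod r = i" if "I \<subseteq> {..<r}" "i \<in> I" for f :: "nat \<Rightarrow> nat" and i I
    using that by auto
  have inj: "inj_on ?\<Phi> ?S"
  proof (rule inj_onI, clarsimp)
    fix I J f g assume I: "I \<subseteq> {..<r}" "f \<in> I \<rightarrow>\<^sub>E {..<a}" and J: "J \<subseteq> {..<r}" "g \<in> J \<rightarrow>\<^sub>E {..<a}"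
      and eq: "(\<lambda>i. f i * r + i) ` I = (\<lambda>i. g i * r + i) ` J"
    have img: "(\<lambda>x. x mod r) ` (\<lambda>i. f i * r + i) ` I = I" if "I \<subseteq> {..<r}" for I f
    proof -
      have "(\<lambda>x. x mod r) ` (\<lambda>i. f i * r + i) ` I = (\<lambda>i. i) ` I"
        unfolding image_image by (intro image_cong refl md[OF that])
      then show ?thesis by simp
    qed
    have IJ: "I = J"
      using img[OF I(1), of f] img[OF J(1), of g] unfolding eq by (rule trans[OF sym])
    have "f i = g i" if i: "i \<in> I" for i
    proof -
      have "f i * r + i \<in> (\<lambda>i. g i * r + i) ` J" using eq i by blast
      then obtain j where j: "j \<in> J" "f i * r + i = g j * r + j" by auto
      then have "i = j" using md[OF I(1) i, of f] md[OF J(1) j(1), of g] by simp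
      then show ?thesis using j(2) assms by simp
    qed
    then show "I = J \<and> f = g" using IJ I J by (auto intro: PiE_ext)
  qed
  have "?\<Phi> ` ?S = cliques (turan_edges r) s {..<r * a}"
  proof (intro equalityI subsetI)
    fix C assume "C \<in> ?\<Phi> ` ?S"
    then obtain I f where I: "I \<subseteq> {..<r}" "card I = s" "f \<in> I \<rightarrow>\<^sub>E {..<a}"
      and C: "C = (\<lambda>i. f i * r + i) ` I" by auto
    have "f i * r + i < r * a" if "i \<in> I" for i
    proof -
      have "f i < a" "i < r" using I that by auto
      then have "f i * r + i < Suc (f i) * r" by simp
      also have "\<dots> \<le> a * r" using \<open>f i < a\<close> by (intro mult_le_mono1) simp
      finally show ?thesis by (simp add: mult.commute)
    qed
    moreover have "inj_on (\<lambda>i. f i * r + i) I"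
      by (rule inj_onI) (metis md[OF I(1), of _ f])
    moreover have "inj_on (\<lambda>x. x mod r) C"
    proof (rule inj_onI)
      fix x y assume "x \<in> C" "y \<in> C" "x mod r = y mod r"
      then obtain i j where "i \<in> I" "j \<in> I" "x = f i * r + i" "y = f j * r + j"
        using C by auto
      then show "x = y" using \<open>x mod r = y mod r\<close> md[OF I(1), of _ f] by metis
    qed
    ultimately show "C \<in> cliques (turan_edges r) s {..<r * a}"
      using I C by (auto simp: cliques_def cl card_image)
  next
    fix C assume "C \<in> cliques (turan_edges r) s {..<r * a}"
    then have C: "C \<subseteq> {..<r * a}" "card C = s" "inj_on (\<lambda>x. x mod r) C"
      by (auto simp: cliques_def cl)
    define I where "I = (\<lambda>x. x mod r) ` C"
    define f where "f = restrict (\<lambda>i. inv_into C (\<lambda>x. x mod r) i div r) I"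
    have f: "f (x mod r) = x div r" if "x \<in> C" for x
      using inv_into_f_f[OF C(3) that] that by (simp add: f_def I_def)
    have "I \<in> ?X" using C assms by (auto simp: I_def card_image)
    moreover have "f \<in> I \<rightarrow>\<^sub>E {..<a}"
    proof (rule PiE_I)
      fix i assume "i \<in> I"
      then obtain x where x: "x \<in> C" "i = x mod r" by (auto simp: I_def)
      then show "f i \<in> {..<a}" using f C(1) by (auto simp: less_mult_imp_div_less mult.commute)
    qed (simp add: f_def)
    moreover have "(\<lambda>i. f i * r + i) ` I = C"
    proof -
      have "(\<lambda>x. f (x mod r) * r + x mod r) ` C = (\<lambda>x. x) ` C"
        by (intro image_cong refl) (simp add: f)
      then show ?thesis by (simp add: I_def image_image)
    qed
    ultimately show "C \<in> ?\<Phi> ` ?S" by (intro image_eqI[of _ _ "(I, f)"]) auto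
  qed
  then have "card (cliques (turan_edges r) s {..<r * a}) = card ?S"
    using card_image[OF inj] by simp
  also have "\<dots> = (\<Sum>I\<in>?X. card (I \<rightarrow>\<^sub>E {..<a}))"
    using finite_subset[of _ "{..<r}"] by (intro card_SigmaI ballI finite_PiE) auto
  also have "\<dots> = (\<Sum>I\<in>?X. a ^ s)"
    using finite_subset[of _ "{..<r}"] by (intro sum.cong refl) (auto simp: card_PiE)
  also have "\<dots> = (r choose s) * a ^ s" by (simp add: n_subsets)
  finally show ?thesis .
qed

lemma mex_ge_turan:
  assumes "2 \<le> r" "2 \<le> s" "(r choose 2) * a\<^sup>2 \<le> m"
  shows "(r choose s) * a ^ s \<le> mex (complete_graph s) m (complete_graph (r + 1))"
proof -
  define V where "V = {..<r * a}"
  define E where "E = cliques (turan_edges r) 2 V"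
  have fV: "finite V" by (simp add: V_def)
  have cl: "cliques E j V = cliques (turan_edges r) j V" for j
    by (auto simp: E_def cliques_def clique_def doubleton_in_turan_edges subset_iff
        card_2_iff insert_commute)
  have s: "simple_graph (Graph V E)"
    using fV by (auto simp: simple_graph_def E_def cliques_def nsets_def intro: finite_subset)
  have c: "card (cliques E j V) = (r choose j) * a ^ j" for j
    using card_cliques_turan_edges[of r j a] assms(1) by (simp add: cl) (simp add: V_def)
  \<comment> \<open>The same count, at \<open>r + 1\<close>, contains the factor
    \<open>r choose (r + 1) = 0\<close>.\<close>
  have free: "cliques E (r + 1) V = {}"
    using c[of "r + 1"] finite_cliques[OF fV, of E "r + 1"] by (simp add: binomial_eq_0)
  have "card E \<le> m"
    using c[of 2] assms(3) unfolding cl E_def[symmetric] by (rule ord_eq_le_trans)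
  then have "kappa s (Graph V E) \<le> mex (complete_graph s) m (complete_graph (r + 1))"
    using kappa_le_mex[OF s, of r m s] free assms(1,2) unfolding graph.sel by blast
  moreover have "kappa s (Graph V E) = (r choose s) * a ^ s"
    using kappa_eq[OF s, of s] c[of s] unfolding graph.sel by (rule trans)
  ultimately show ?thesis by (simp only:)
qed

section \<open>Reduction to dense graphs\<close>

text \<open>Turns an excess over \<open>mex\<close> into an excess over
  \<open>c * m powr (s / 2)\<close>. The Turan graph has parts of size \<open>a\<close>, the integer
  part of \<open>y = sqrt (m / (r choose 2))\<close>; by Bernoulli's inequality, rounding costs a
  proportion of at most \<open>s / y\<close>.\<close>

lemma mex_asymptotic_lower_bound:
  fixes \<eta> :: real
  assumes "2 \<le> r" "2 \<le> s" "0 < \<eta>"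
  defines "c \<equiv> real (r choose s) / sqrt (real (r choose 2)) ^ s"
  shows "\<exists>m\<^sub>1. \<forall>m\<ge>m\<^sub>1. (c - \<eta>) * sqrt (real m) ^ s
    \<le> real (mex (complete_graph s) m (complete_graph (r + 1)))"
proof -
  define b where "b = real (r choose 2)"
  define A where "A = real (r choose s)"
  have "0 < r choose 2" using assms(1) by simp
  then have b: "1 \<le> b" unfolding b_def by linarith
  define L where "L = max 1 (A * real s / \<eta>)"
  define m1 where "m1 = nat \<lceil>b * L\<^sup>2\<rceil>"
  have "(c - \<eta>) * sqrt (real m) ^ s \<le> real (mex (complete_graph s) m (complete_graph (r + 1)))"
    if m: "m1 \<le> m" for m
  proof -
    define y where "y = sqrt (real m / b)"
    define a where "a = nat \<lfloor>y\<rfloor>"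
    have "b * L\<^sup>2 \<le> real m" using m by (simp add: m1_def)
    then have "L\<^sup>2 \<le> real m / b" using b by (simp add: field_simps)
    then have yL: "L \<le> y" unfolding y_def by (rule real_le_rsqrt)
    then have y1: "1 \<le> y" "A * real s / \<eta> \<le> y" by (auto simp: L_def)
    have ay: "real a \<le> y" "y - 1 \<le> real a" using y1 by (auto simp: a_def)
    have "b * (real a)\<^sup>2 \<le> b * y\<^sup>2" using ay b by (intro mult_left_mono power_mono) auto
    also have "\<dots> = real m" using b by (simp add: y_def)
    finally have "real ((r choose 2) * a\<^sup>2) \<le> real m" by (simp add: b_def)
    then have "(r choose 2) * a\<^sup>2 \<le> m" by (simp only: of_nat_le_iff)
    from mex_ge_turan[OF assms(1,2) this] have lower: "A * real a ^ s \<le> real (mex (complete_graph s) m (complete_graph (r + 1)))"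
      unfolding A_def of_nat_power[symmetric] of_nat_mult[symmetric] of_nat_le_iff .
    have ym: "y \<le> sqrt (real m)" "0 \<le> y"
      using b y1 by (auto simp: y_def intro!: divide_le_eq[THEN iffD2] mult_left_mono
          simp: real_sqrt_le_mono)
    have "y ^ s * (1 - real s / y) \<le> y ^ s * (1 - 1 / y) ^ s"
      using Bernoulli_inequality[of "- (1 / y)" s] y1 by (intro mult_left_mono) auto
    also have "\<dots> = (y - 1) ^ s" using y1 by (simp add: right_diff_distrib flip: power_mult_distrib)
    also have "\<dots> \<le> real a ^ s" using ay y1 by (intro power_mono) auto
    finally have "A * (y ^ s * (1 - real s / y)) \<le> A * real a ^ s"
      by (intro mult_left_mono) (auto simp: A_def)
    moreover have "A * (y ^ s * (1 - real s / y)) = A * y ^ s - (A * real s / y) * y ^ s"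
      by (simp add: algebra_simps)
    moreover have "A * y ^ s = c * sqrt (real m) ^ s"
      by (simp add: A_def c_def y_def b_def real_sqrt_divide power_divide)
    moreover have "(A * real s / y) * y ^ s \<le> \<eta> * sqrt (real m) ^ s"
    proof (intro mult_mono power_mono)
      show "A * real s / y \<le> \<eta>" using y1 assms(3) by (simp add: field_simps)
    qed (use ym assms(3) in auto)
    ultimately show ?thesis using lower by (simp add: left_diff_distrib)
  qed
  then show ?thesis by blast
qed

section \<open>Vertices of high and low degree\<close>

lemma sum_card_nbrs_le:
  assumes "finite V"
  shows "(\<Sum>v\<in>V. card (nbrs E v V)) \<le> 2 * card (cliques E 2 V)"
proof -
  have "card (nbrs E v V) \<le> card {e \<in> cliques E 2 V. v \<in> e}" if "v \<in> V" for v
  proof (rule card_inj_on_le[of "\<lambda>w. {v, w}"])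
    show "inj_on (\<lambda>w. {v, w}) (nbrs E v V)" by (auto simp: inj_on_def doubleton_eq_iff)
    show "(\<lambda>w. {v, w}) ` nbrs E v V \<subseteq> {e \<in> cliques E 2 V. v \<in> e}"
      using that by (auto simp: nbrs_def cliques_def clique_def insert_commute)
    show "finite {e \<in> cliques E 2 V. v \<in> e}" using finite_cliques[OF assms] by simp
  qed
  then have "(\<Sum>v\<in>V. card (nbrs E v V)) \<le> (\<Sum>v\<in>V. card {e \<in> cliques E 2 V. v \<in> e})"
    by (intro sum_mono)
  also have "\<dots> = (\<Sum>v\<in>V. \<Sum>e\<in>cliques E 2 V. if v \<in> e then 1 else 0)"
    using finite_cliques[OF assms] by (simp add: sum.If_cases Int_def)
  also have "\<dots> = (\<Sum>e\<in>cliques E 2 V. \<Sum>v\<in>V. if v \<in> e then 1 else 0)"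
    by (rule sum.swap)
  also have "\<dots> = (\<Sum>e\<in>cliques E 2 V. 2)"
  proof (intro sum.cong refl)
    fix e assume "e \<in> cliques E 2 V"
    then have "V \<inter> {v. v \<in> e} = e" "card e = 2" by (auto simp: cliques_def)
    then show "(\<Sum>v\<in>V. if v \<in> e then 1 else 0) = (2 :: nat)"
      using assms by (simp add: sum.If_cases)
  qed
  finally show ?thesis by (simp add: mult.commute)
qed

lemma card_high_degree_le:
  fixes D :: real
  assumes "finite V"
  shows "D * real (card {v \<in> V. D \<le> real (card (nbrs E v V))}) \<le> 2 * real (card (cliques E 2 V))"
proof -
  let ?W = "{v \<in> V. D \<le> real (card (nbrs E v V))}"
  have "D * real (card ?W) = (\<Sum>v\<in>?W. D)" by simp
  also have "\<dots> \<le> (\<Sum>v\<in>?W. real (card (nbrs E v V)))" by (intro sum_mono) auto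
  also have "\<dots> \<le> (\<Sum>v\<in>V. real (card (nbrs E v V)))" using assms by (intro sum_mono2) auto
  also have "\<dots> \<le> 2 * real (card (cliques E 2 V))"
    using sum_card_nbrs_le[OF assms, of E] by (simp flip: of_nat_sum)
  finally show ?thesis .
qed

text \<open>A clique not inside \<open>W\<close> consists of some \<open>v\<close> of degree below
  \<open>D\<close> and an \<open>s - 1\<close>-clique among its neighbours. There are at most
  \<open>deg ^ (s - 1) \<le> deg * D ^ (s - 2)\<close> of these, and the degrees sum to at most
  twice the number of edges.\<close>

lemma card_cliques_le_high_degree:
  fixes D :: real and E :: "'a set set"
  assumes "finite V" "2 \<le> s" "0 \<le> D"
  defines "W \<equiv> {v \<in> V. D \<le> real (card (nbrs E v V))}"
  shows "real (card (cliques E s V))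
    \<le> real (card (cliques E s W)) + 2 * real (card (cliques E 2 V)) * D ^ (s - 2)"
proof -
  obtain s' where s': "s = Suc (Suc s')" using assms(2) by (metis add_2_eq_Suc le_Suc_ex)
  let ?U = "\<Union>v\<in>V - W. insert v ` cliques E (Suc s') (nbrs E v V)"
  have fU: "finite ?U" using assms(1) by (auto intro: finite_cliques finite_nbrs)
  have fW: "finite (cliques E s W)" using assms(1) by (intro finite_cliques) (simp add: W_def)
  have "cliques E s V \<subseteq> cliques E s W \<union> ?U"
  proof
    fix C assume C: "C \<in> cliques E s V"
    show "C \<in> cliques E s W \<union> ?U"
    proof (cases "C \<subseteq> W")
      case False
      then obtain v where v: "v \<in> C" "v \<in> V - W" using C by (auto simp: cliques_def)
      then have "C \<in> insert v ` cliques E (Suc s') (nbrs E v V)"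
        using cliques_Suc[OF assms(1), of v E "Suc s'"] C v by (auto simp: s' cliques_def)
      then show ?thesis using v by blast
    qed (use C in \<open>auto simp: cliques_def\<close>)
  qed
  then have "card (cliques E s V) \<le> card (cliques E s W \<union> ?U)"
    using fU fW by (intro card_mono) auto
  also have "\<dots> \<le> card (cliques E s W) + card ?U" by (rule card_Un_le)
  finally have 1: "real (card (cliques E s V)) \<le> real (card (cliques E s W)) + real (card ?U)"
    by linarith
  have "card ?U \<le> (\<Sum>v\<in>V - W. card (insert v ` cliques E (Suc s') (nbrs E v V)))"
    using assms(1) by (intro card_UN_le) simp
  also have "\<dots> \<le> (\<Sum>v\<in>V - W. card (nbrs E v V) ^ Suc s')"
    using assms(1) by (intro sum_mono order_trans[OF card_image_le] card_cliques_le_power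
        finite_cliques finite_nbrs)
  finally have "real (card ?U) \<le> (\<Sum>v\<in>V - W. real (card (nbrs E v V)) ^ Suc s')"
    by (simp flip: of_nat_power of_nat_sum del: power_Suc)
  also have "\<dots> \<le> (\<Sum>v\<in>V - W. real (card (nbrs E v V)) * D ^ s')"
    by (auto simp: W_def intro!: sum_mono mult_left_mono power_mono)
  also have "\<dots> = (\<Sum>v\<in>V - W. real (card (nbrs E v V))) * D ^ s'"
    by (simp add: sum_distrib_right)
  also have "\<dots> \<le> 2 * real (card (cliques E 2 V)) * D ^ s'"
  proof -
    have "(\<Sum>v\<in>V - W. card (nbrs E v V)) \<le> (\<Sum>v\<in>V. card (nbrs E v V))"
      using assms(1) by (intro sum_mono2) auto
    then have "(\<Sum>v\<in>V - W. card (nbrs E v V)) \<le> 2 * card (cliques E 2 V)"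
      using sum_card_nbrs_le[OF assms(1), of E] by linarith
    then have "(\<Sum>v\<in>V - W. real (card (nbrs E v V))) \<le> 2 * real (card (cliques E 2 V))"
      by (simp flip: of_nat_sum)
    then show ?thesis using assms(3) by (intro mult_right_mono) auto
  qed
  finally show ?thesis using 1 by (simp add: s')
qed

text \<open>Distinctness of \<open>y\<close> and \<open>z\<close> in the edge condition makes the
  parts disjoint, so the bijections onto the single parts glue to one on the whole blowup.\<close>

lemma contains_blowup_complete_graph:
  assumes "simple_graph G" "1 \<le> t"
    and Y: "\<And>i. i < q \<Longrightarrow> Y i \<subseteq> verts G" "\<And>i. i < q \<Longrightarrow> card (Y i) = t"
    and edge: "\<And>i j y z. i < q \<Longrightarrow> j < q \<Longrightarrow> i \<noteq> j \<Longrightarrow> y \<in> Y i \<Longrightarrow> z \<in> Y j \<Longrightarrow>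
      y \<noteq> z \<and> {y, z} \<in> edges G"
  shows "contains G (blowup (complete_graph q) t)"
proof -
  define E' where "E' = {{y, z} | y z. \<exists>i<q. \<exists>j<q. i \<noteq> j \<and> y \<in> Y i \<and> z \<in> Y j}"
  define H where "H = Graph (\<Union>i<q. Y i) E'"
  have "\<exists>h. bij_betw h {..<t} (Y i)" if "i < q" for i
  proof -
    have "finite (Y i)" using Y(2)[OF that] assms(2) by (intro card_ge_0_finite) simp
    then show ?thesis using Y(2)[OF that] by (simp add: bij_betw_iff_card)
  qed
  then have "\<forall>i\<in>{..<q}. \<exists>h. bij_betw h {..<t} (Y i)" by simp
  from bchoice[OF this] obtain h where h: "\<And>i. i < q \<Longrightarrow> bij_betw (h i) {..<t} (Y i)" by auto
  define f where "f = (\<lambda>(i, l). h i l)"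
  have hY: "h i ` {..<t} = Y i" if "i < q" for i using h[OF that] by (simp add: bij_betw_def)
  have "bij_betw f ({..<q} \<times> {..<t}) (\<Union>i<q. Y i)"
    unfolding bij_betw_def
  proof
    show "inj_on f ({..<q} \<times> {..<t})"
    proof (rule inj_onI)
      fix x y assume x: "x \<in> {..<q} \<times> {..<t}" and y: "y \<in> {..<q} \<times> {..<t}" and "f x = f y"
      obtain i l j k where xy: "x = (i, l)" "y = (j, k)" by (metis surj_pair)
      have eq: "h i l = h j k" using \<open>f x = f y\<close> by (simp add: f_def xy)
      have "h i l \<in> Y i" "h j k \<in> Y j" using x y hY by (auto simp: xy)
      then have "i = j" using edge[of i j "h i l" "h j k"] eq x y by (auto simp: xy)
      then show "x = y" using h[of i] eq x y by (auto simp: xy bij_betw_def inj_on_def)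
    qed
    have "f ` ({..<q} \<times> {..<t}) = (\<Union>i<q. h i ` {..<t})" by (auto simp: f_def)
    then show "f ` ({..<q} \<times> {..<t}) = (\<Union>i<q. Y i)" using hY by simp
  qed
  moreover have "E' = (\<lambda>e. f ` e) ` edges (blowup (complete_graph q) t)"
  proof (intro equalityI subsetI)
    fix e assume "e \<in> E'"
    then obtain y z i j where e: "e = {y, z}" "i < q" "j < q" "i \<noteq> j" "y \<in> Y i" "z \<in> Y j"
      unfolding E'_def by blast
    then obtain k l where kl: "k < t" "l < t" "y = h i k" "z = h j l"
      using hY[of i, symmetric] hY[of j, symmetric] by auto
    then have "{(i, k), (j, l)} \<in> edges (blowup (complete_graph q) t)"
      using e by (auto simp: blowup_def complete_graph_def)
    moreover have "e = f ` {(i, k), (j, l)}" by (simp add: f_def e kl)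
    ultimately show "e \<in> (\<lambda>e. f ` e) ` edges (blowup (complete_graph q) t)" by blast
  next
    fix e assume "e \<in> (\<lambda>e. f ` e) ` edges (blowup (complete_graph q) t)"
    then obtain i j k l where e: "e = f ` {(i, k), (j, l)}" "i < q" "j < q" "i \<noteq> j" "k < t" "l < t"
      by (auto simp: blowup_def complete_graph_def)
    then have "e = {h i k, h j l}" "h i k \<in> Y i" "h j l \<in> Y j" using hY by (auto simp: f_def)
    then show "e \<in> E'" using e unfolding E'_def by blast
  qed
  ultimately have "isomorphic (blowup (complete_graph q) t) H"
    unfolding isomorphic_def H_def by (intro exI[of _ f]) (simp add: blowup_def complete_graph_def)
  moreover have "(\<Union>i<q. Y i) \<subseteq> verts G" using Y(1) by blast
  moreover have "E' \<subseteq> edges G" using edge unfolding E'_def by blast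
  moreover have "E' \<subseteq> [\<Union>i<q. Y i]\<^bsup>2\<^esup>" using edge unfolding E'_def by auto
  ultimately have "H \<in> copies (blowup (complete_graph q) t) G"
    using assms(1) finite_subset[of "\<Union>i<q. Y i" "verts G"]
    by (simp add: copies_def H_def subgraph_def simple_graph_def)
  then show ?thesis by (auto simp: contains_def)
qed

theorem theorem1p9:
  fixes r s t :: nat and \<epsilon> :: real
  assumes "r \<ge> 3" and "s \<ge> 3" and "t \<ge> 1" and "\<epsilon> > 0"
  shows "\<exists>m\<^sub>0 :: nat. \<forall>m \<ge> m\<^sub>0. \<forall>G :: 'a graph.
    simple_graph G \<longrightarrow> card (edges G) = m \<longrightarrow>
    real (kappa s G) \<ge> real (mex (complete_graph s) m (complete_graph (r + 1))) + \<epsilon> * real m powr (real s / 2) \<longrightarrow>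
    contains G (blowup (complete_graph (r + 1)) t)"
proof -
  define c where "c = real (r choose s) / sqrt (real (r choose 2)) ^ s"
  have c0: "c \<ge> 0" by (simp add: c_def)
  \<comment> \<open>The budget in units of \<open>\<epsilon> * m powr (s / 2)\<close>: 1/4 for
    estimating \<open>mex\<close>, 1/4 for cliques through low degrees, 1/8 for the dense part,
    together less than 1.\<close>
  obtain m1 where m1: "\<And>m. m1 \<le> m \<Longrightarrow> (c - \<epsilon> / 4) * sqrt (real m) ^ s
      \<le> real (mex (complete_graph s) m (complete_graph (r + 1)))"
    using mex_asymptotic_lower_bound[of r s "\<epsilon> / 4"] assms unfolding c_def by auto
  define \<delta> where "\<delta> = min 1 (\<epsilon> / 8)"
  have \<delta>: "0 < \<delta>" "\<delta> \<le> 1" "2 * \<delta> \<le> \<epsilon> / 4" using assms(4) by (auto simp: \<delta>_def)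
  \<comment> \<open>The dense part errs by \<open>\<beta> * n ^ s\<close> with
    \<open>n \<le> 2 / \<delta> * sqrt m\<close>, which comes to 1/8. Half of \<open>\<beta>\<close>
    pays for sampling, through the choice of \<open>l\<close>, and half for the
    \<open>r + 1\<close>-cliques, through \<open>\<rho>\<close>.\<close>
  define \<beta> where "\<beta> = \<epsilon> / 8 / (2 / \<delta>) ^ s"
  have \<beta>: "\<beta> > 0" "(2 / \<delta>) ^ s * \<beta> = \<epsilon> / 8" using assms(4) \<delta> by (auto simp: \<beta>_def)
  define a where "a = (real s)\<^sup>2 + 2 * c * real s"
  have a: "a \<ge> 0" using c0 by (simp add: a_def)
  define l where "l = max (s + r + 1) (nat \<lceil>2 * a / \<beta>\<rceil>)"
  have l: "s + r + 1 \<le> l" "2 * a / \<beta> \<le> real l"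
    unfolding l_def of_nat_max by (rule max.cobounded1, rule max.coboundedI2, rule real_nat_ceiling_ge)
  have "l \<le> l\<^sup>2" by (simp add: power2_eq_square)
  then have l2: "4 \<le> l\<^sup>2" "s \<le> l\<^sup>2" "r + 1 \<le> l\<^sup>2" using l(1) assms(1,2) by linarith+
  have small: "(real s)\<^sup>2 / (real l)\<^sup>2 + 2 * c * real s / real l \<le> \<beta> / 2"
  proof -
    have l1: "real l \<ge> 1" using l(1) by simp
    have "(real s)\<^sup>2 / (real l)\<^sup>2 \<le> (real s)\<^sup>2 / real l"
      using l1 by (intro divide_left_mono) (auto simp: power2_eq_square)
    then have "(real s)\<^sup>2 / (real l)\<^sup>2 + 2 * c * real s / real l \<le> a / real l"
      by (simp add: a_def add_divide_distrib)
    also have "\<dots> \<le> \<beta> / 2" using l(2) l1 \<beta>(1) by (simp add: field_simps)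
    finally show ?thesis .
  qed
  define \<Lambda> where "\<Lambda> = real (l\<^sup>2) ^ (r + 1)"
  have "0 < l\<^sup>2" using l2 by linarith
  then have \<Lambda>: "\<Lambda> > 0"
    unfolding \<Lambda>_def of_nat_0_less_iff[symmetric, where ?'a = real] by (rule zero_less_power)
  define \<rho> where "\<rho> = \<beta> / 2 / \<Lambda>"
  have \<rho>: "\<rho> > 0" "\<Lambda> * \<rho> = \<beta> / 2"
    unfolding \<rho>_def using \<beta>(1) \<Lambda> by (intro divide_pos_pos, simp_all)
  from many_cliques_imp_blowup[OF \<rho>(1) assms(3), of "r + 1"]
  obtain n0 where n0: "\<forall>(W :: 'a set) E. finite W \<longrightarrow> n0 \<le> card W \<longrightarrow>
    \<rho> * real (card W) ^ (r + 1) \<le> real (card (cliques E (r + 1) W)) \<longrightarrow>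
    (\<exists>Y. (\<forall>i<r + 1. Y i \<subseteq> W \<and> card (Y i) = t) \<and>
      (\<forall>i<r + 1. \<forall>j<r + 1. i \<noteq> j \<longrightarrow> (\<forall>y\<in>Y i. \<forall>z\<in>Y j. y \<noteq> z \<and> {y, z} \<in> E)))"
    by (elim exE)
  define N1 where "N1 = max n0 (l\<^sup>2)"
  \<comment> \<open>The square gives \<open>N1 ^ s \<le> \<epsilon> / 8 * sqrt m\<close>, so that
    fewer than \<open>N1\<close> vertices of high degree cannot carry the excess.\<close>
  define m0 where "m0 = max (max 1 m1) (nat \<lceil>(real N1 ^ s * 8 / \<epsilon>)\<^sup>2\<rceil>)"
  have "contains G (blowup (complete_graph (r + 1)) t)"
    if G: "simple_graph G" "card (edges G) = m" and m: "m0 \<le> m"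
      and kap: "real (kappa s G) \<ge> real (mex (complete_graph s) m (complete_graph (r + 1)))
        + \<epsilon> * real m powr (real s / 2)" for m and G :: "'a graph"
  proof -
    define V where "V = verts G"
    define E where "E = edges G"
    have fV: "finite V" using G(1) by (simp add: V_def simple_graph_def)
    have m12: "1 \<le> m" "m1 \<le> m" "(real N1 ^ s * 8 / \<epsilon>)\<^sup>2 \<le> real m" using m by (auto simp: m0_def)
    define x where "x = sqrt (real m)"
    have x: "x \<ge> 1" "x\<^sup>2 = real m" "x > 0" using m12(1) by (auto simp: x_def)
    have xs: "x ^ s > 0" using x by simp
    have "real m powr (real s / 2) = x ^ s"
      using x by (simp add: x_def powr_half_sqrt[symmetric] powr_powr powr_realpow[symmetric])
    then have kap': "real (card (cliques E s V)) \<ge> real (mex (complete_graph s) m (complete_graph (r + 1)))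
        + \<epsilon> * x ^ s"
      using kap by (simp add: kappa_eq[OF G(1)] V_def E_def)
    have edges: "card (cliques E 2 V) = m"
      using edges_eq_cliques[OF G(1)] G(2) by (simp add: V_def E_def)
    define W where "W = {v \<in> V. \<delta> * x \<le> real (card (nbrs E v V))}"
    have W: "finite W" "W \<subseteq> V" using fV by (auto simp: W_def)
    define n where "n = card W"
    have "\<delta> * x * real n \<le> 2 * x\<^sup>2"
      using card_high_degree_le[OF fV, of "\<delta> * x" E] edges x(2) by (simp add: n_def W_def)
    then have n_le: "real n \<le> 2 / \<delta> * x"
      using \<delta>(1) x(3) by (simp add: field_simps power2_eq_square)
    have "2 * real m * (\<delta> * x) ^ (s - 2) \<le> 2 * \<delta> * x ^ s"
    proof -
      have "\<delta> ^ (s - 2) \<le> \<delta> ^ 1" using \<delta> assms(2) by (intro power_decreasing) auto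
      then have "\<delta> ^ (s - 2) * x ^ s \<le> \<delta> * x ^ s" using xs by simp
      moreover have "x ^ s = real m * x ^ (s - 2)"
      proof -
        have "2 + (s - 2) = s" using assms(2) by simp
        then show ?thesis using x(2) by (metis power_add)
      qed
      ultimately show ?thesis by (simp add: power_mult_distrib mult_ac)
    qed
    moreover have "2 * \<delta> * x ^ s \<le> \<epsilon> / 4 * x ^ s"
      using \<delta>(3) xs by (intro mult_right_mono) auto
    moreover have "real (card (cliques E s V))
        \<le> real (card (cliques E s W)) + 2 * real m * (\<delta> * x) ^ (s - 2)"
      using card_cliques_le_high_degree[OF fV, of s "\<delta> * x" E] assms(2) edges \<delta>(1) x(3)
      by (simp add: W_def)
    ultimately have low: "real (card (cliques E s V)) \<le> real (card (cliques E s W)) + \<epsilon> / 4 * x ^ s"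
      by linarith
    have "N1 \<le> n"
    proof (rule ccontr)
      assume "\<not> N1 \<le> n"
      then have "card (cliques E s W) \<le> N1 ^ s"
        using card_cliques_le_power[OF W(1), of E s] power_mono[of n N1 s] by (simp add: n_def)
      then have "real (card (cliques E s W)) \<le> real N1 ^ s" by (simp flip: of_nat_power)
      moreover have "real N1 ^ s * 8 / \<epsilon> \<le> x" unfolding x_def by (rule real_le_rsqrt[OF m12(3)])
      then have "real N1 ^ s * 8 \<le> \<epsilon> * x" using assms(4) by (simp add: field_simps)
      moreover have "x \<le> x ^ s" using x assms(2) by (intro self_le_power) auto
      then have "\<epsilon> * x \<le> \<epsilon> * x ^ s" using assms(4) by simp
      moreover have "\<epsilon> * x ^ s > 0" using assms(4) xs by simp
      ultimately show False using low kap' by linarith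
    qed
    then have nN: "n0 \<le> card W" "l\<^sup>2 \<le> card W" by (auto simp: N1_def n_def)
    have npos: "real n > 0" using nN(2) l2(1) by (simp add: n_def)
    \<comment> \<open>With fewer \<open>r + 1\<close>-cliques, \<open>W\<close> would obey the
      clique-free bound up to the 1/8 of the budget, contradicting the excess.\<close>
    have "\<rho> * real (card W) ^ (r + 1) \<le> real (card (cliques E (r + 1) W))"
    proof (rule ccontr)
      assume "\<not> ?thesis"
      then have few: "real (card (cliques E (r + 1) W)) / real n ^ (r + 1) \<le> \<rho>"
        using npos by (simp add: n_def field_simps)
      have "\<Lambda> * (real (card (cliques E (r + 1) W)) / real n ^ (r + 1)) \<le> \<beta> / 2"
        unfolding \<rho>(2)[symmetric] using \<Lambda> by (intro mult_left_mono few) simp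
      then have "\<Lambda> * real (card (cliques E (r + 1) W)) / real n ^ (r + 1) \<le> \<beta> / 2"
        by (simp only: times_divide_eq_right)
      with small have err: "(real s)\<^sup>2 / (real l)\<^sup>2 + 2 * c * real s / real l
          + \<Lambda> * real (card (cliques E (r + 1) W)) / real n ^ (r + 1) \<le> \<beta>"
        by linarith
      have "card (cliques E 2 W) \<le> m"
        unfolding edges[symmetric] by (intro card_mono finite_cliques cliques_mono fV W(2))
      then have sq: "sqrt (real (card (cliques E 2 W))) \<le> x" by (simp add: x_def)
      have "real (card (cliques E s W)) \<le> c * sqrt (real (card (cliques E 2 W))) ^ s
        + real n ^ s * ((real s)\<^sup>2 / (real l)\<^sup>2 + 2 * c * real s / real l
        + \<Lambda> * real (card (cliques E (r + 1) W)) / real n ^ (r + 1))"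
        unfolding c_def n_def \<Lambda>_def using assms(1,2) l2 nN(2) W(1)
        by (intro card_cliques_le_supersaturated) auto
      also have "\<dots> \<le> c * x ^ s + (2 / \<delta> * x) ^ s * \<beta>"
      proof (rule add_mono)
        show "c * sqrt (real (card (cliques E 2 W))) ^ s \<le> c * x ^ s"
          using sq c0 by (intro mult_left_mono power_mono) auto
        show "real n ^ s * ((real s)\<^sup>2 / (real l)\<^sup>2 + 2 * c * real s / real l
            + \<Lambda> * real (card (cliques E (r + 1) W)) / real n ^ (r + 1)) \<le> (2 / \<delta> * x) ^ s * \<beta>"
          using n_le \<delta>(1) x(3) c0 \<Lambda> by (intro mult_mono err power_mono) auto
      qed
      also have "(2 / \<delta> * x) ^ s * \<beta> = \<epsilon> / 8 * x ^ s"
        using \<beta>(2) by (simp only: power_mult_distrib) (simp add: mult_ac)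
      finally have "real (card (cliques E s W)) \<le> c * x ^ s + \<epsilon> / 8 * x ^ s" .
      moreover have "c * x ^ s - \<epsilon> / 4 * x ^ s
          \<le> real (mex (complete_graph s) m (complete_graph (r + 1)))"
        using m1[OF m12(2)] by (simp add: x_def left_diff_distrib)
      moreover have "\<epsilon> * x ^ s > 0" using assms(4) xs by simp
      ultimately show False using low kap' by linarith
    qed
    from n0[rule_format, OF W(1) nN(1) this] obtain Y where
      Y: "\<forall>i<r + 1. Y i \<subseteq> W \<and> card (Y i) = t"
        "\<forall>i<r + 1. \<forall>j<r + 1. i \<noteq> j \<longrightarrow> (\<forall>y\<in>Y i. \<forall>z\<in>Y j. y \<noteq> z \<and> {y, z} \<in> E)"
      by blast
    show ?thesis
    proof (rule contains_blowup_complete_graph[OF G(1) assms(3)])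
      fix i assume i: "i < r + 1"
      have "Y i \<subseteq> W" "card (Y i) = t" using Y(1) i by blast+
      then show "Y i \<subseteq> verts G" "card (Y i) = t" using W(2) unfolding V_def by blast+
    next
      fix i j y z assume "i < r + 1" "j < r + 1" "i \<noteq> j" "y \<in> Y i" "z \<in> Y j"
      then show "y \<noteq> z \<and> {y, z} \<in> edges G" using Y(2) unfolding E_def by blast
    qed
  qed
  then show ?thesis by blast
qed

end
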